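(* Every amenable discrete group has the $p$-invariant translation approximation property ($p$-ITAP) for all $p\in(1,\infty)$.
   Context: Convention: a discrete group $\Gamma$ is equipped with a proper right-invariant metric $d$ (i.e. $d(sg,tg)=d(s,t)$ and all balls are finite; in particular $\Gamma$ is countable), and $|\Gamma|$ denotes the resulting metric space, which has bounded geometry. For $T\in B(\ell^p(\Gamma))$ write $T_{s,t}=\langle T\delta_t,\delta_s\rangle$ and $\mathrm{prop}(T)=\sup\{d(s,t):T_{s,t}\neq0\}$. $B^p_u|\Gamma|$ is the operator norm closure in $B(\ell^p(\Gamma))$ of the algebra of operators with finite propagation. (An operator has finite propagation iff there is a finite $F\subseteq\Gamma$ with $T_{s,t}=0$ unless $st^{-1}\in F$, so $B^p_u|\Gamma|$ does not depend on the metric chosen.) The left and right regular representations on $\ell^p(\Gamma)$ are $(\lambda_sf)(t)=f(s^{-1}t)$ and $(\rho_sf)(t)=f(ts)$. $F^p_\lambda(\Gamma)$ is the norm-closed subalgebra of $B(\ell^p(\Gamma))$ generated by $\lambda(\Gamma)$; it is contained in $B^p_u|\Gamma|$. $\Gamma$ acts on $B^p_u|\Gamma|$ by $\mathrm{Ad}(\rho_g)(T)=\rho_gT\rho_{g^{-1}}$, and $B^p_u|\Gamma|^\Gamma$ denotes the set of fixed points. For $1<p<\infty$, $\Gamma$ has the $p$-ITAP if $F^p_\lambda(\Gamma)=B^p_u|\Gamma|^\Gamma$. *)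

theory Defs
  imports "HOL-Analysis.Analysis" "HOL-Algebra.Group"
begin

section \<open>The spaces of p-summable functions and their bounded operators\<close>

text \<open>
  Functions on an index set \<open>I\<close> are represented by total functions vanishing outside \<open>I\<close>.
  Operators are represented by functions that are \<open>undefined\<close> outside the space they
  act on, so that HOL equality of representatives is equality of operators.
\<close>

definition ellp :: "real \<Rightarrow> 'a set \<Rightarrow> ('a \<Rightarrow> complex) set" where
  "ellp p I = {f. (\<lambda>x. norm (f x) powr p) summable_on I \<and> (\<forall>x. x \<notin> I \<longrightarrow> f x = 0)}"

definition ellp_norm :: "real \<Rightarrow> 'a set \<Rightarrow> ('a \<Rightarrow> complex) \<Rightarrow> real" where
  "ellp_norm p I f = (\<Sum>\<^sub>\<infinity>x\<in>I. norm (f x) powr p) powr (1 / p)"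

type_synonym 'a operator = "('a \<Rightarrow> complex) \<Rightarrow> ('a \<Rightarrow> complex)"

definition bounded_ops :: "real \<Rightarrow> 'a set \<Rightarrow> 'a operator set" where
  "bounded_ops p I = {T \<in> ellp p I \<rightarrow>\<^sub>E ellp p I.
     (\<forall>f\<in>ellp p I. \<forall>g\<in>ellp p I. T (\<lambda>x. f x + g x) = (\<lambda>x. T f x + T g x)) \<and>
     (\<forall>c. \<forall>f\<in>ellp p I. T (\<lambda>x. c * f x) = (\<lambda>x. c * T f x)) \<and>
     (\<exists>K. \<forall>f\<in>ellp p I. ellp_norm p I (T f) \<le> K * ellp_norm p I f)}"

definition op_norm :: "real \<Rightarrow> 'a set \<Rightarrow> 'a operator \<Rightarrow> real" where
  "op_norm p I T = (SUP f\<in>{f \<in> ellp p I. ellp_norm p I f \<le> 1}. ellp_norm p I (T f))"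

definition op_zero :: "real \<Rightarrow> 'a set \<Rightarrow> 'a operator" where
  "op_zero p I = (\<lambda>f\<in>ellp p I. (\<lambda>x. 0))"

definition op_add :: "real \<Rightarrow> 'a set \<Rightarrow> 'a operator \<Rightarrow> 'a operator \<Rightarrow> 'a operator" where
  "op_add p I S T = (\<lambda>f\<in>ellp p I. (\<lambda>x. S f x + T f x))"

definition op_diff :: "real \<Rightarrow> 'a set \<Rightarrow> 'a operator \<Rightarrow> 'a operator \<Rightarrow> 'a operator" where
  "op_diff p I S T = (\<lambda>f\<in>ellp p I. (\<lambda>x. S f x - T f x))"

definition op_scale :: "real \<Rightarrow> 'a set \<Rightarrow> complex \<Rightarrow> 'a operator \<Rightarrow> 'a operator" where
  "op_scale p I c T = (\<lambda>f\<in>ellp p I. (\<lambda>x. c * T f x))"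

definition op_mult :: "real \<Rightarrow> 'a set \<Rightarrow> 'a operator \<Rightarrow> 'a operator \<Rightarrow> 'a operator" where
  "op_mult p I S T = compose (ellp p I) S T"

definition op_closure :: "real \<Rightarrow> 'a set \<Rightarrow> 'a operator set \<Rightarrow> 'a operator set" where
  "op_closure p I W =
     {T \<in> bounded_ops p I. \<forall>e>0. \<exists>S\<in>W. op_norm p I (op_diff p I T S) < e}"

definition closed_subalgebra :: "real \<Rightarrow> 'a set \<Rightarrow> 'a operator set \<Rightarrow> bool" where
  "closed_subalgebra p I W \<longleftrightarrow>
     W \<subseteq> bounded_ops p I \<and>
     op_zero p I \<in> W \<and>
     (\<forall>S\<in>W. \<forall>T\<in>W. op_add p I S T \<in> W) \<and>
     (\<forall>c. \<forall>T\<in>W. op_scale p I c T \<in> W) \<and>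
     (\<forall>S\<in>W. \<forall>T\<in>W. op_mult p I S T \<in> W) \<and>
     op_closure p I W = W"

text \<open>The matrix coefficient \<open>\<langle>T \<delta>\<^sub>t, \<delta>\<^sub>s\<rangle>\<close> is the value of \<open>T \<delta>\<^sub>t\<close> at \<open>s\<close>.\<close>

definition delta :: "'a \<Rightarrow> 'a \<Rightarrow> complex" where
  "delta t = (\<lambda>x. if x = t then 1 else 0)"

definition mat_coeff :: "'a operator \<Rightarrow> 'a \<Rightarrow> 'a \<Rightarrow> complex" where
  "mat_coeff T s t = T (delta t) s"


section \<open>Uniform Roe algebras\<close>

text \<open>
  The supremum is taken in the extended nonnegative reals; thus the zero operator has
  propagation 0.
\<close>

definition propagation :: "'a set \<Rightarrow> ('a \<Rightarrow> 'a \<Rightarrow> real) \<Rightarrow> 'a operator \<Rightarrow> ennreal" where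
  "propagation I d T = Sup {ennreal (d s t) |s t. s \<in> I \<and> t \<in> I \<and> mat_coeff T s t \<noteq> 0}"

definition uniform_Roe :: "real \<Rightarrow> 'a set \<Rightarrow> ('a \<Rightarrow> 'a \<Rightarrow> real) \<Rightarrow> 'a operator set" where
  "uniform_Roe p I d = op_closure p I {T \<in> bounded_ops p I. propagation I d T < \<infinity>}"


section \<open>Groups\<close>

definition proper_right_invariant_metric ::
    "('a, 'b) monoid_scheme \<Rightarrow> ('a \<Rightarrow> 'a \<Rightarrow> real) \<Rightarrow> bool" where
  "proper_right_invariant_metric G d \<longleftrightarrow>
     Metric_space (carrier G) d \<and>
     (\<forall>s\<in>carrier G. \<forall>t\<in>carrier G. \<forall>g\<in>carrier G. d (s \<otimes>\<^bsub>G\<^esub> g) (t \<otimes>\<^bsub>G\<^esub> g) = d s t) \<and>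
     (\<forall>x\<in>carrier G. \<forall>r. finite (Metric_space.mcball (carrier G) d x r))"

definition left_translate ::
    "('a, 'b) monoid_scheme \<Rightarrow> 'a \<Rightarrow> ('a \<Rightarrow> complex) \<Rightarrow> 'a \<Rightarrow> complex" where
  "left_translate G s f = (\<lambda>t. if t \<in> carrier G then f (inv\<^bsub>G\<^esub> s \<otimes>\<^bsub>G\<^esub> t) else 0)"

definition right_translate ::
    "('a, 'b) monoid_scheme \<Rightarrow> 'a \<Rightarrow> ('a \<Rightarrow> complex) \<Rightarrow> 'a \<Rightarrow> complex" where
  "right_translate G s f = (\<lambda>t. if t \<in> carrier G then f (t \<otimes>\<^bsub>G\<^esub> s) else 0)"

definition ell_infty :: "'a set \<Rightarrow> ('a \<Rightarrow> complex) set" where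
  "ell_infty I = {f. bounded (f ` I) \<and> (\<forall>x. x \<notin> I \<longrightarrow> f x = 0)}"

text \<open>
  Amenability in the sense of the existence of a left-invariant mean, that is, a positive
  unital linear functional on the bounded functions that is invariant under left translation.
\<close>

definition invariant_mean ::
    "('a, 'b) monoid_scheme \<Rightarrow> (('a \<Rightarrow> complex) \<Rightarrow> complex) \<Rightarrow> bool" where
  "invariant_mean G m \<longleftrightarrow>
     (\<forall>f\<in>ell_infty (carrier G). \<forall>g\<in>ell_infty (carrier G). m (\<lambda>x. f x + g x) = m f + m g) \<and>
     (\<forall>c. \<forall>f\<in>ell_infty (carrier G). m (\<lambda>x. c * f x) = c * m f) \<and>
     (\<forall>f\<in>ell_infty (carrier G). (\<forall>x\<in>carrier G. f x \<in> \<real>\<^sub>\<ge>\<^sub>0) \<longrightarrow> m f \<in> \<real>\<^sub>\<ge>\<^sub>0) \<and>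
     m (indicator (carrier G)) = 1 \<and>
     (\<forall>s\<in>carrier G. \<forall>f\<in>ell_infty (carrier G). m (left_translate G s f) = m f)"

definition amenable :: "('a, 'b) monoid_scheme \<Rightarrow> bool" where
  "amenable G \<longleftrightarrow> (\<exists>m. invariant_mean G m)"

definition left_regular :: "real \<Rightarrow> ('a, 'b) monoid_scheme \<Rightarrow> 'a \<Rightarrow> 'a operator" where
  "left_regular p G s = restrict (left_translate G s) (ellp p (carrier G))"

definition right_regular :: "real \<Rightarrow> ('a, 'b) monoid_scheme \<Rightarrow> 'a \<Rightarrow> 'a operator" where
  "right_regular p G s = restrict (right_translate G s) (ellp p (carrier G))"

definition reduced_group_algebra :: "real \<Rightarrow> ('a, 'b) monoid_scheme \<Rightarrow> 'a operator set" where
  "reduced_group_algebra p G =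
     closed_subalgebra p (carrier G) hull (left_regular p G ` carrier G)"

definition Ad_right_regular ::
    "real \<Rightarrow> ('a, 'b) monoid_scheme \<Rightarrow> 'a \<Rightarrow> 'a operator \<Rightarrow> 'a operator" where
  "Ad_right_regular p G g T =
     op_mult p (carrier G) (right_regular p G g)
       (op_mult p (carrier G) T (right_regular p G (inv\<^bsub>G\<^esub> g)))"

definition invariant_uniform_Roe ::
    "real \<Rightarrow> ('a, 'b) monoid_scheme \<Rightarrow> ('a \<Rightarrow> 'a \<Rightarrow> real) \<Rightarrow> 'a operator set" where
  "invariant_uniform_Roe p G d =
     {T \<in> uniform_Roe p (carrier G) d. \<forall>g\<in>carrier G. Ad_right_regular p G g T = T}"

definition ITAP :: "real \<Rightarrow> ('a, 'b) monoid_scheme \<Rightarrow> ('a \<Rightarrow> 'a \<Rightarrow> real) \<Rightarrow> bool" where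
  "ITAP p G d \<longleftrightarrow> reduced_group_algebra p G = invariant_uniform_Roe p G d"

end

theory Submission
  imports Defs
begin

text \<open>
  The reduced group algebra is the norm closure of the finitely supported convolution operators.
  These are invariant and have finite propagation, and both properties pass to the closure in the
  required form. Conversely, let \<open>T\<close> be invariant and let \<open>S\<close> have finite propagation. Averaging
  the conjugates of \<open>S\<close> by right translations with an invariant mean \<open>m\<close> gives a convolution
  operator \<open>R\<close>: the row of \<open>S\<close> at \<open>g\<close> has its entries at \<open>inv h \<otimes> g\<close> with \<open>h\<close> in a fixed finite
  ball, and the coefficient of \<open>R\<close> at \<open>h\<close> is the mean over \<open>g\<close> of these entries. Averaging fixes
  \<open>T\<close>, so \<open>(T - R) f\<close> is the pointwise mean of the images of \<open>f\<close> under the conjugates of \<open>T - S\<close>,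
  and Jensen's inequality for \<open>m\<close> shows that \<open>T - R\<close> has norm at most that of \<open>T - S\<close>.
\<close>

section \<open>The spaces of p-summable functions\<close>

lemma powr_above_tangent:
  fixes a b p :: real
  assumes "0 \<le> a" "0 \<le> b" "1 < p"
  shows "b powr p + p * b powr (p - 1) * (a - b) \<le> a powr p"
\<comment> \<open>The tangent argument takes place on the open half-line. At the boundary the left
  side is \<open>(1 - p) * b powr p\<close> when \<open>a = 0\<close>, and 0 when
  \<open>b = 0\<close>.\<close>
proof (cases "a = 0 \<or> b = 0")
  case True
  moreover have "b powr p = b powr (p - 1) * b" if "b > 0"
    using that powr_add[of b "p - 1" 1] by simp
  ultimately show ?thesis
    using assms by (cases "b = 0") (auto simp: algebra_simps intro!: mult_right_mono)
next
  case False
  then have "0 < a" "0 < b" using assms by auto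
  have "a powr p - b powr p \<ge> p * b powr (p - 1) * (a - b)"
  proof (rule convex_on_imp_above_tangent[where A = "{0<..}"])
    show "convex_on {0<..} (\<lambda>x. x powr p)" using powr_convex assms by auto
    show "((\<lambda>x. x powr p) has_real_derivative p * b powr (p - 1)) (at b within {0<..})"
      using \<open>0 < b\<close> by (auto intro!: derivative_eq_intros)
  qed (use \<open>0 < a\<close> \<open>0 < b\<close> in \<open>auto simp: interior_open\<close>)
  then show ?thesis by simp
qed

text \<open>The tangent at the combined point \<open>w\<close> lies below the power at
  \<open>u\<close> and at \<open>v\<close>; in the weighted sum the linear terms cancel because
  \<open>k * (u - w) + l * (v - w) = 0\<close>.\<close>

lemma powr_convex_combination:
  fixes u v k l p :: real
  assumes "0 \<le> u" "0 \<le> v" "0 \<le> k" "0 \<le> l" "k + l = 1" "1 < p"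
  shows "(k * u + l * v) powr p \<le> k * u powr p + l * v powr p"
proof -
  define w where "w = k * u + l * v"
  have w: "0 \<le> w" unfolding w_def using assms by auto
  have "k * (w powr p + p * w powr (p - 1) * (u - w)) + l * (w powr p + p * w powr (p - 1) * (v - w))
      \<le> k * u powr p + l * v powr p"
    using assms w by (intro add_mono mult_left_mono powr_above_tangent) auto
  also have "k * (w powr p + p * w powr (p - 1) * (u - w)) + l * (w powr p + p * w powr (p - 1) * (v - w))
      = (k + l) * w powr p + p * w powr (p - 1) * (w - (k + l) * w)"
    unfolding w_def by (simp add: algebra_simps)
  finally show ?thesis using assms unfolding w_def by simp
qed

text \<open>After division by \<open>a + b\<close>, the norm of \<open>f + g\<close> is dominated
  pointwise by a convex combination of the norms of \<open>f / a\<close> and \<open>g / b\<close>,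
  so convexity of the power can be summed. Working with bounds on finite sums makes the inequality
  usable before \<open>f + g\<close> is known to be p-summable.\<close>

lemma Minkowski_powr_sum:
  fixes f g :: "'a \<Rightarrow> complex" and a b p :: real
  assumes "0 < a" "0 < b" "1 < p"
    and f: "(\<Sum>x\<in>F. norm (f x) powr p) \<le> a powr p"
    and g: "(\<Sum>x\<in>F. norm (g x) powr p) \<le> b powr p"
  shows "(\<Sum>x\<in>F. norm (f x + g x) powr p) \<le> (a + b) powr p"
proof -
  define k l where "k = a / (a + b)" and "l = b / (a + b)"
  have kl: "0 \<le> k" "0 \<le> l" "k + l = 1"
    using assms unfolding k_def l_def by (auto simp: add_divide_distrib[symmetric])
  have "norm (f x + g x) powr p
      \<le> (a + b) powr p * (k * (norm (f x) powr p / a powr p) + l * (norm (g x) powr p / b powr p))" for x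
  proof -
    have "norm (f x + g x) \<le> norm (f x) + norm (g x)"
      by (rule norm_triangle_ineq)
    also have "\<dots> = (a + b) * (k * (norm (f x) / a) + l * (norm (g x) / b))"
    proof -
      have "(a + b) * k = a" "(a + b) * l = b"
        using assms unfolding k_def l_def by auto
      then have "(a + b) * (k * u + l * v) = a * u + b * v" for u v
        by (metis distrib_left mult.assoc)
      from this[of "norm (f x) / a" "norm (g x) / b"] show ?thesis
        using assms by simp
    qed
    finally have "norm (f x + g x) powr p \<le> \<dots> powr p"
      using assms by (intro powr_mono2) auto
    also have "\<dots> = (a + b) powr p * (k * (norm (f x) / a) + l * (norm (g x) / b)) powr p"
      by (rule powr_mult)
    also have "\<dots> \<le> (a + b) powr p * (k * (norm (f x) / a) powr p + l * (norm (g x) / b) powr p)"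
      using assms kl by (intro mult_left_mono powr_convex_combination) auto
    finally show ?thesis using assms by (simp add: powr_divide)
  qed
  then have "(\<Sum>x\<in>F. norm (f x + g x) powr p)
      \<le> (\<Sum>x\<in>F. (a + b) powr p * (k * (norm (f x) powr p / a powr p) + l * (norm (g x) powr p / b powr p)))"
    by (intro sum_mono)
  also have "\<dots> = (a + b) powr p * (k * ((\<Sum>x\<in>F. norm (f x) powr p) / a powr p)
      + l * ((\<Sum>x\<in>F. norm (g x) powr p) / b powr p))"
    by (simp add: sum_distrib_left sum.distrib sum_divide_distrib algebra_simps)
  also have "\<dots> \<le> (a + b) powr p * (k * 1 + l * 1)"
    using assms kl by (intro mult_left_mono add_mono) auto
  finally show ?thesis using kl by simp
qed

lemma small_multiple_le:
  fixes C e :: real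
  assumes "0 \<le> C" "0 < e"
  obtains d where "0 < d" "C * d \<le> e"
proof
  \<comment> \<open>The added 1 keeps the denominator positive when \<open>C = 0\<close>.\<close>
  show "0 < e / (C + 1)" using assms by simp
  have "C * (e / (C + 1)) = (C / (C + 1)) * e" by simp
  also have "\<dots> \<le> 1 * e" using assms by (intro mult_right_mono) auto
  finally show "C * (e / (C + 1)) \<le> e" by simp
qed

section \<open>The normed space of p-summable functions\<close>

locale ellp_space =
  fixes p :: real and I :: "'a set"
  assumes p_gt_1: "1 < p"
begin

abbreviation "L \<equiv> ellp p I"
abbreviation "N \<equiv> ellp_norm p I"

lemma ellp_outside: "f \<in> L \<Longrightarrow> x \<notin> I \<Longrightarrow> f x = 0"
  by (simp add: ellp_def)

lemma norm_nonneg [simp]: "0 \<le> N f"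
  by (simp add: ellp_norm_def)

lemma norm_powr: "N f powr p = (\<Sum>\<^sub>\<infinity>x\<in>I. norm (f x) powr p)"
  unfolding ellp_norm_def using p_gt_1 by (simp add: powr_powr infsum_nonneg)

lemma sum_le_norm:
  assumes "f \<in> L" "finite F" "F \<subseteq> I"
  shows "(\<Sum>x\<in>F. norm (f x) powr p) \<le> N f powr p"
  unfolding norm_powr using assms by (intro finite_sum_le_infsum) (auto simp: ellp_def)

text \<open>A nonnegative family with bounded finite partial sums is summable. Together with
  \<open>norm_leI\<close> this reduces norm estimates to finite sums, which matters for an invariant
  mean, since it need not commute with infinite sums.\<close>

lemma ellpI:
  assumes "\<And>x. x \<notin> I \<Longrightarrow> f x = 0"
    and "\<And>F. finite F \<Longrightarrow> F \<subseteq> I \<Longrightarrow> (\<Sum>x\<in>F. norm (f x) powr p) \<le> C powr p"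
  shows "f \<in> L"
  unfolding ellp_def
  using assms by (auto intro!: nonneg_bdd_above_summable_on bdd_aboveI[of _ "C powr p"])

lemma norm_leI:
  assumes "f \<in> L" "0 \<le> C"
    and "\<And>F. finite F \<Longrightarrow> F \<subseteq> I \<Longrightarrow> (\<Sum>x\<in>F. norm (f x) powr p) \<le> C powr p"
  shows "N f \<le> C"
proof -
  have "N f powr p \<le> C powr p"
    unfolding norm_powr using assms by (intro infsum_le_finite_sums) (auto simp: ellp_def)
  then show ?thesis
    using assms(2) p_gt_1 powr_less_mono2[of p C "N f"] by fastforce
qed

lemma norm_component_le:
  assumes "f \<in> L"
  shows "norm (f x) \<le> N f"
proof (cases "x \<in> I")
  case True
  have "norm (f x) powr p \<le> N f powr p"
    using sum_le_norm[OF assms, of "{x}"] True by simp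
  then show ?thesis
    using p_gt_1 by (metis norm_ge_zero norm_nonneg not_less powr_less_mono2 less_trans zero_less_one)
qed (use assms in \<open>simp add: ellp_outside\<close>)

lemma norm_eq_0D: "f \<in> L \<Longrightarrow> N f = 0 \<Longrightarrow> f = (\<lambda>x. 0)"
  using norm_component_le by fastforce

lemma zero_in_ellp [simp]: "(\<lambda>x. 0) \<in> L"
  by (simp add: ellp_def)

lemma norm_zero [simp]: "N (\<lambda>x. 0) = 0"
  using p_gt_1 by (simp add: ellp_norm_def)

lemma ellp_finite_support:
  assumes "finite {x. f x \<noteq> 0}" "{x. f x \<noteq> 0} \<subseteq> I"
  shows "f \<in> L"
proof -
  have "(\<lambda>x. norm (f x) powr p) summable_on I \<longleftrightarrow> (\<lambda>x. norm (f x) powr p) summable_on {x. f x \<noteq> 0}"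
    by (rule summable_on_cong_neutral) (use assms in auto)
  then show ?thesis
    using assms by (auto simp: ellp_def)
qed

lemma delta_in_ellp [simp]: "t \<in> I \<Longrightarrow> delta t \<in> L"
  by (rule ellp_finite_support) (auto simp: delta_def)

lemma scale_in_ellp: "f \<in> L \<Longrightarrow> (\<lambda>x. c * f x) \<in> L"
  using p_gt_1 by (auto simp: ellp_def norm_mult powr_mult intro!: summable_on_cmult_right)

lemma norm_scale: "N (\<lambda>x. c * f x) = norm c * N f"
  unfolding ellp_norm_def using p_gt_1
  by (simp add: norm_mult powr_mult infsum_cmult_right' infsum_nonneg powr_powr)

lemma
  assumes f: "f \<in> L" and g: "g \<in> L"
  shows add_in_ellp: "(\<lambda>x. f x + g x) \<in> L"
    and norm_add_le: "N (\<lambda>x. f x + g x) \<le> N f + N g"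
proof -
  have "(\<lambda>x. f x + g x) \<in> L \<and> N (\<lambda>x. f x + g x) \<le> N f + N g"
  \<comment> \<open>\<open>Minkowski_powr_sum\<close> needs positive bounds; a summand of norm 0 is
    the zero function.\<close>
  proof (cases "N f = 0 \<or> N g = 0")
    case True
    then show ?thesis
      using f g norm_eq_0D[OF f] norm_eq_0D[OF g] by fastforce
  next
    case False
    then have *: "(\<Sum>x\<in>F. norm (f x + g x) powr p) \<le> (N f + N g) powr p" if "finite F" "F \<subseteq> I" for F
      using that f g p_gt_1 norm_nonneg[of f] norm_nonneg[of g]
      by (intro Minkowski_powr_sum sum_le_norm) (simp_all add: less_le)
    have "(\<lambda>x. f x + g x) \<in> L"
      using * f g by (intro ellpI) (auto simp: ellp_outside)
    then show ?thesis
      using * by (auto intro!: norm_leI)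
  qed
  then show "(\<lambda>x. f x + g x) \<in> L" "N (\<lambda>x. f x + g x) \<le> N f + N g" by auto
qed

lemma diff_in_ellp: "f \<in> L \<Longrightarrow> g \<in> L \<Longrightarrow> (\<lambda>x. f x - g x) \<in> L"
  using add_in_ellp[of f "\<lambda>x. (-1) * g x"] scale_in_ellp[of g "-1"] by simp

lemma sum_in_ellp:
  assumes "\<And>h. h \<in> F \<Longrightarrow> f h \<in> L"
  shows "(\<lambda>x. \<Sum>h\<in>F. f h x) \<in> L"
  using assms by (induction F rule: infinite_finite_induct) (auto intro: add_in_ellp)

text \<open>A finite partial sum within \<open>e powr p\<close> of the whole sum leaves at most
  \<open>e powr p\<close> outside \<open>F\<close>. This is the density of the finitely supported
  functions.\<close>

lemma norm_restrict_tail_small: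
  assumes f: "f \<in> L" and "0 < e"
  obtains F where "finite F" "F \<subseteq> I" "(\<lambda>x. if x \<in> F then 0 else f x) \<in> L"
    "N (\<lambda>x. if x \<in> F then 0 else f x) \<le> e"
proof -
  have sm: "(\<lambda>x. norm (f x) powr p) summable_on I" using f by (simp add: ellp_def)
  obtain F where F: "finite F" "F \<subseteq> I"
    and d: "dist (\<Sum>x\<in>F. norm (f x) powr p) (\<Sum>\<^sub>\<infinity>x\<in>I. norm (f x) powr p) \<le> e powr p"
    using infsum_finite_approximation[OF sm, of "e powr p"] \<open>0 < e\<close> by auto
  let ?g = "\<lambda>x. if x \<in> F then 0 else f x"
  have *: "(\<Sum>x\<in>K. norm (?g x) powr p) \<le> e powr p" if "finite K" "K \<subseteq> I" for K
  proof -
    have "(\<Sum>x\<in>K. norm (?g x) powr p) = (\<Sum>x\<in>K - F. norm (f x) powr p)"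
      using that by (intro sum.mono_neutral_cong_right) auto
    also have "\<dots> + (\<Sum>x\<in>F. norm (f x) powr p) = (\<Sum>x\<in>K \<union> F. norm (f x) powr p)"
      using that F by (subst sum.union_disjoint[symmetric]) (auto intro: sum.cong)
    also have "\<dots> \<le> (\<Sum>\<^sub>\<infinity>x\<in>I. norm (f x) powr p)"
      using that F sm by (intro finite_sum_le_infsum) auto
    finally show ?thesis using d by (auto simp: dist_real_def)
  qed
  have "?g \<in> L" by (rule ellpI[OF _ *]) (use f in \<open>auto simp: ellp_outside\<close>)
  then show thesis using that[OF F _ norm_leI[OF _ _ *]] \<open>0 < e\<close> by simp
qed

section \<open>Bounded operators\<close>

lemma bounded_opsI:
  assumes "T \<in> extensional L"
    and "\<And>f. f \<in> L \<Longrightarrow> T f \<in> L"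
    and "\<And>f g. f \<in> L \<Longrightarrow> g \<in> L \<Longrightarrow> T (\<lambda>x. f x + g x) = (\<lambda>x. T f x + T g x)"
    and "\<And>c f. f \<in> L \<Longrightarrow> T (\<lambda>x. c * f x) = (\<lambda>x. c * T f x)"
    and "\<And>f. f \<in> L \<Longrightarrow> N (T f) \<le> K * N f"
  shows "T \<in> bounded_ops p I"
  using assms unfolding bounded_ops_def PiE_def by blast

lemma
  assumes "T \<in> bounded_ops p I"
  shows op_ext: "T \<in> extensional L"
    and op_in: "\<And>f. f \<in> L \<Longrightarrow> T f \<in> L"
    and op_additive: "\<And>f g. f \<in> L \<Longrightarrow> g \<in> L \<Longrightarrow> T (\<lambda>x. f x + g x) = (\<lambda>x. T f x + T g x)"
    and op_homogeneous: "\<And>c f. f \<in> L \<Longrightarrow> T (\<lambda>x. c * f x) = (\<lambda>x. c * T f x)"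
  using assms unfolding bounded_ops_def PiE_def by auto

text \<open>The constant in \<open>bounded_ops\<close> carries no sign, so \<open>max K 0\<close>
  replaces it; later estimates are multiplied by this constant and need it nonnegative.\<close>

lemma op_bound:
  assumes "T \<in> bounded_ops p I"
  shows "\<exists>K\<ge>0. \<forall>f\<in>L. N (T f) \<le> K * N f"
proof -
  obtain K where "\<forall>f\<in>L. N (T f) \<le> K * N f"
    using assms unfolding bounded_ops_def by auto
  then have "\<forall>f\<in>L. N (T f) \<le> max K 0 * N f"
    by (meson max.cobounded1 mult_right_mono norm_nonneg order_trans)
  then show ?thesis by (meson max.cobounded2)
qed

lemma op_zero_arg: "T \<in> bounded_ops p I \<Longrightarrow> T (\<lambda>x. 0) = (\<lambda>x. 0)"
  using op_homogeneous[of T "\<lambda>x. 0" 0] by simp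

lemma op_subtractive:
  assumes "T \<in> bounded_ops p I" "f \<in> L" "g \<in> L"
  shows "T (\<lambda>x. f x - g x) = (\<lambda>x. T f x - T g x)"
  using op_additive[OF assms(1,2) scale_in_ellp[OF assms(3)], of "-1"] op_homogeneous[OF assms(1,3), of "-1"]
  by simp

section \<open>The operator norm\<close>

lemma op_norm_le:
  assumes "0 \<le> C" "\<And>f. f \<in> L \<Longrightarrow> N (T f) \<le> C * N f"
  shows "op_norm p I T \<le> C"
  unfolding op_norm_def
proof (rule cSUP_least)
  show "{f \<in> L. N f \<le> 1} \<noteq> {}" by (auto intro: exI[of _ "\<lambda>x. 0"])
  fix f assume "f \<in> {f \<in> L. N f \<le> 1}"
  then show "N (T f) \<le> C"
    using assms(2)[of f] mult_left_mono[of "N f" 1 C] \<open>0 \<le> C\<close> by simp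
qed

text \<open>Homogeneity reduces the claim to the unit vector \<open>f / N f\<close>. Boundedness of
  \<open>T\<close> supplies \<open>bdd_above\<close>, which lets the real supremum in
  \<open>op_norm\<close> be compared with its members.\<close>

lemma norm_le_op_norm:
  assumes T: "T \<in> bounded_ops p I" and f: "f \<in> L"
  shows "N (T f) \<le> op_norm p I T * N f"
proof (cases "N f = 0")
  case True
  then show ?thesis using norm_eq_0D[OF f] op_zero_arg[OF T] by simp
next
  case False
  then have pos: "0 < N f" by (simp add: less_le)
  obtain K where K: "0 \<le> K" "\<And>f. f \<in> L \<Longrightarrow> N (T f) \<le> K * N f" by (meson op_bound[OF T])
  let ?c = "complex_of_real (1 / N f)"
  have "N (T (\<lambda>x. ?c * f x)) \<le> op_norm p I T"
    unfolding op_norm_def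
  proof (rule cSUP_upper)
    show "(\<lambda>x. ?c * f x) \<in> {f \<in> L. N f \<le> 1}"
      using scale_in_ellp[OF f, of ?c] norm_scale[of ?c f] pos unfolding mem_Collect_eq norm_of_real by simp
    have "N (T g) \<le> K" if "g \<in> L" "N g \<le> 1" for g
      using K(2)[OF that(1)] mult_left_mono[OF that(2) K(1)] by simp
    then show "bdd_above ((\<lambda>f. N (T f)) ` {f \<in> L. N f \<le> 1})"
      by (auto intro!: bdd_aboveI[of _ K])
  qed
  then show ?thesis
    using pos unfolding op_homogeneous[OF T f] norm_scale by (simp add: norm_divide field_simps)
qed

section \<open>Sums, multiples and products of bounded operators\<close>

lemma op_zero_bounded: "op_zero p I \<in> bounded_ops p I"
  by (rule bounded_opsI[where K = 0]) (auto simp: op_zero_def add_in_ellp scale_in_ellp)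

lemma op_scale_bounded:
  assumes "T \<in> bounded_ops p I"
  shows "op_scale p I c T \<in> bounded_ops p I"
proof -
  obtain K where K: "0 \<le> K" "\<And>f. f \<in> L \<Longrightarrow> N (T f) \<le> K * N f" by (meson op_bound[OF assms])
  have "norm c * N (T f) \<le> (norm c * K) * N f" if "f \<in> L" for f
    using mult_left_mono[OF K(2)[OF that], of "norm c"] by (simp add: mult.assoc)
  then show ?thesis
    by (intro bounded_opsI[where K = "norm c * K"])
      (auto simp: op_scale_def add_in_ellp scale_in_ellp op_in[OF assms] op_additive[OF assms]
        op_homogeneous[OF assms] norm_scale distrib_left mult.left_commute)
qed

lemma op_add_bounded:
  assumes "S \<in> bounded_ops p I" "T \<in> bounded_ops p I"
  shows "op_add p I S T \<in> bounded_ops p I"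
proof -
  obtain K where K: "0 \<le> K" "\<And>f. f \<in> L \<Longrightarrow> N (S f) \<le> K * N f" by (meson op_bound[OF assms(1)])
  obtain M where M: "0 \<le> M" "\<And>f. f \<in> L \<Longrightarrow> N (T f) \<le> M * N f" by (meson op_bound[OF assms(2)])
  have "N (\<lambda>x. S f x + T f x) \<le> (K + M) * N f" if "f \<in> L" for f
    using norm_add_le[OF op_in[OF assms(1) that] op_in[OF assms(2) that]] K(2)[OF that] M(2)[OF that]
    by (simp add: algebra_simps)
  then show ?thesis
    by (intro bounded_opsI[where K = "K + M"])
      (auto simp: op_add_def add_in_ellp scale_in_ellp op_in[OF assms(1)] op_in[OF assms(2)]
        op_additive[OF assms(1)] op_additive[OF assms(2)] op_homogeneous[OF assms(1)]
        op_homogeneous[OF assms(2)] algebra_simps)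
qed

lemma op_diff_eq: "op_diff p I S T = op_add p I S (op_scale p I (-1) T)"
  by (auto simp: op_diff_def op_add_def op_scale_def)

lemma op_diff_bounded:
  "S \<in> bounded_ops p I \<Longrightarrow> T \<in> bounded_ops p I \<Longrightarrow> op_diff p I S T \<in> bounded_ops p I"
  unfolding op_diff_eq by (intro op_add_bounded op_scale_bounded)

lemma op_mult_bounded:
  assumes "S \<in> bounded_ops p I" "T \<in> bounded_ops p I"
  shows "op_mult p I S T \<in> bounded_ops p I"
proof -
  obtain K where K: "0 \<le> K" "\<And>f. f \<in> L \<Longrightarrow> N (S f) \<le> K * N f" by (meson op_bound[OF assms(1)])
  obtain M where M: "0 \<le> M" "\<And>f. f \<in> L \<Longrightarrow> N (T f) \<le> M * N f" by (meson op_bound[OF assms(2)])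
  have "N (S (T f)) \<le> (K * M) * N f" if "f \<in> L" for f
    using K(2)[OF op_in[OF assms(2) that]] mult_left_mono[OF M(2)[OF that] K(1)]
    by (simp add: mult.assoc)
  then show ?thesis
    by (intro bounded_opsI[where K = "K * M"])
      (auto simp: op_mult_def compose_def add_in_ellp scale_in_ellp op_in[OF assms(1)] op_in[OF assms(2)]
        op_additive[OF assms(1)] op_additive[OF assms(2)] op_homogeneous[OF assms(1)]
        op_homogeneous[OF assms(2)])
qed

section \<open>Closures\<close>

text \<open>An \<open>op_norm\<close> below \<open>e\<close> controls every vector by homogeneity,
  and a bound on all vectors controls the supremum. Later approximations are carried out with such
  vector estimates instead of operator norms.\<close>

lemma op_closure_iff:
  assumes "W \<subseteq> bounded_ops p I"
  shows "T \<in> op_closure p I W \<longleftrightarrow> T \<in> bounded_ops p I \<and>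
    (\<forall>e>0. \<exists>S\<in>W. \<forall>f\<in>L. N (\<lambda>x. T f x - S f x) \<le> e * N f)" (is "_ \<longleftrightarrow> _ \<and> ?approx")
proof (cases "T \<in> bounded_ops p I")
  case T: True
  have "(\<forall>e>0. \<exists>S\<in>W. op_norm p I (op_diff p I T S) < e) \<longleftrightarrow> ?approx"
  proof (intro iffI allI impI)
    fix e :: real assume "\<forall>e>0. \<exists>S\<in>W. op_norm p I (op_diff p I T S) < e" "0 < e"
    then obtain S where S: "S \<in> W" "op_norm p I (op_diff p I T S) < e" by auto
    have "N (\<lambda>x. T f x - S f x) \<le> e * N f" if "f \<in> L" for f
    proof -
      have "op_diff p I T S \<in> bounded_ops p I" using S(1) assms T by (auto intro: op_diff_bounded)
      from norm_le_op_norm[OF this that]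
      have "N (\<lambda>x. T f x - S f x) \<le> op_norm p I (op_diff p I T S) * N f"
        using that by (simp add: op_diff_def)
      then show ?thesis
        using mult_right_mono[OF less_imp_le[OF S(2)], of "N f"] by simp
    qed
    then show "\<exists>S\<in>W. \<forall>f\<in>L. N (\<lambda>x. T f x - S f x) \<le> e * N f" using S(1) by blast
  next
    fix e :: real assume *: ?approx and "0 < e"
    \<comment> \<open>Halving \<open>e\<close> turns the non-strict estimate into the strict
      inequality required by \<open>op_closure\<close>.\<close>
    then obtain S where S: "S \<in> W" "\<And>f. f \<in> L \<Longrightarrow> N (\<lambda>x. T f x - S f x) \<le> e / 2 * N f"
      by (meson half_gt_zero)
    have "op_norm p I (op_diff p I T S) \<le> e / 2"
      by (rule op_norm_le) (use S(2) \<open>0 < e\<close> in \<open>auto simp: op_diff_def\<close>)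
    then show "\<exists>S\<in>W. op_norm p I (op_diff p I T S) < e"
      using S(1) \<open>0 < e\<close> by (intro bexI[of _ S]) auto
  qed
  then show ?thesis using T by (auto simp: op_closure_def)
qed (auto simp: op_closure_def)

lemma op_closure_approx:
  assumes "W \<subseteq> bounded_ops p I" "T \<in> op_closure p I W" "0 < e"
  obtains S where "S \<in> W" "S \<in> bounded_ops p I" "\<And>f. f \<in> L \<Longrightarrow> N (\<lambda>x. T f x - S f x) \<le> e * N f"
  using assms op_closure_iff[OF assms(1), of T] by blast

lemma op_closure_bounded: "op_closure p I W \<subseteq> bounded_ops p I"
  by (auto simp: op_closure_def)

lemma op_closure_mono: "V \<subseteq> W \<Longrightarrow> op_closure p I V \<subseteq> op_closure p I W"
  unfolding op_closure_def by blast

lemma norm_diff_triangle: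
  assumes "f \<in> L" "g \<in> L" "h \<in> L"
  shows "N (\<lambda>x. f x - h x) \<le> N (\<lambda>x. f x - g x) + N (\<lambda>x. g x - h x)"
  using norm_add_le[OF diff_in_ellp[OF assms(1,2)] diff_in_ellp[OF assms(2,3)]] by simp

lemma subset_op_closure: "W \<subseteq> bounded_ops p I \<Longrightarrow> W \<subseteq> op_closure p I W"
  by (subst subset_iff) (force simp: op_closure_iff)

lemma op_closure_idem:
  assumes "W \<subseteq> bounded_ops p I"
  shows "op_closure p I (op_closure p I W) = op_closure p I W"
proof (rule antisym)
  show "op_closure p I W \<subseteq> op_closure p I (op_closure p I W)"
    by (rule subset_op_closure[OF op_closure_bounded])
  show "op_closure p I (op_closure p I W) \<subseteq> op_closure p I W"
  proof
    fix T assume T: "T \<in> op_closure p I (op_closure p I W)"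
    then have Tb: "T \<in> bounded_ops p I" using op_closure_bounded by blast
    have "\<exists>S\<in>W. \<forall>f\<in>L. N (\<lambda>x. T f x - S f x) \<le> e * N f" if "0 < e" for e
    proof -
      obtain R where R: "R \<in> op_closure p I W" "R \<in> bounded_ops p I"
        "\<And>f. f \<in> L \<Longrightarrow> N (\<lambda>x. T f x - R f x) \<le> e / 2 * N f"
        using op_closure_approx[OF op_closure_bounded T, of "e / 2"] \<open>0 < e\<close> by auto
      obtain S where S: "S \<in> W" "S \<in> bounded_ops p I"
        "\<And>f. f \<in> L \<Longrightarrow> N (\<lambda>x. R f x - S f x) \<le> e / 2 * N f"
        using op_closure_approx[OF assms R(1), of "e / 2"] \<open>0 < e\<close> by auto
      have "N (\<lambda>x. T f x - S f x) \<le> e * N f" if f: "f \<in> L" for f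
        using norm_diff_triangle[OF op_in[OF Tb f] op_in[OF R(2) f] op_in[OF S(2) f]] R(3)[OF f] S(3)[OF f]
        by simp
      then show ?thesis using S(1) by blast
    qed
    then show "T \<in> op_closure p I W" using Tb op_closure_iff[OF assms] by blast
  qed
qed

text \<open>The algebraic operations are continuous, so approximants from \<open>W\<close> combine
  to approximants of the result.\<close>

lemma closed_subalgebra_op_closure:
  assumes W: "W \<subseteq> bounded_ops p I"
    and zero: "op_zero p I \<in> W"
    and add: "\<And>S T. S \<in> W \<Longrightarrow> T \<in> W \<Longrightarrow> op_add p I S T \<in> W"
    and scale: "\<And>c T. T \<in> W \<Longrightarrow> op_scale p I c T \<in> W"
    and mult: "\<And>S T. S \<in> W \<Longrightarrow> T \<in> W \<Longrightarrow> op_mult p I S T \<in> W"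
  shows "closed_subalgebra p I (op_closure p I W)"
  unfolding closed_subalgebra_def
proof (intro conjI ballI allI)
  show "op_closure p I W \<subseteq> bounded_ops p I" by (rule op_closure_bounded)
  show "op_zero p I \<in> op_closure p I W" using zero subset_op_closure[OF W] by blast
  show "op_closure p I (op_closure p I W) = op_closure p I W" by (rule op_closure_idem[OF W])
next
  fix S T assume ST: "S \<in> op_closure p I W" "T \<in> op_closure p I W"
  then have b: "S \<in> bounded_ops p I" "T \<in> bounded_ops p I" using op_closure_bounded by blast+
  have "\<exists>R\<in>W. \<forall>f\<in>L. N (\<lambda>x. op_add p I S T f x - R f x) \<le> e * N f" if "0 < e" for e
  proof -
    obtain S' where S': "S' \<in> W" "S' \<in> bounded_ops p I"
      "\<And>f. f \<in> L \<Longrightarrow> N (\<lambda>x. S f x - S' f x) \<le> e / 2 * N f"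
      using op_closure_approx[OF W ST(1), of "e / 2"] \<open>0 < e\<close> by auto
    obtain T' where T': "T' \<in> W" "T' \<in> bounded_ops p I"
      "\<And>f. f \<in> L \<Longrightarrow> N (\<lambda>x. T f x - T' f x) \<le> e / 2 * N f"
      using op_closure_approx[OF W ST(2), of "e / 2"] \<open>0 < e\<close> by auto
    have "N (\<lambda>x. op_add p I S T f x - op_add p I S' T' f x) \<le> e * N f" if f: "f \<in> L" for f
    proof -
      have "N (\<lambda>x. op_add p I S T f x - op_add p I S' T' f x)
          = N (\<lambda>x. (S f x - S' f x) + (T f x - T' f x))"
        using f by (simp add: op_add_def algebra_simps)
      also have "\<dots> \<le> N (\<lambda>x. S f x - S' f x) + N (\<lambda>x. T f x - T' f x)"
        by (intro norm_add_le diff_in_ellp op_in[OF b(1) f] op_in[OF b(2) f] op_in[OF S'(2) f] op_in[OF T'(2) f])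
      finally show ?thesis using S'(3)[OF f] T'(3)[OF f] by simp
    qed
    then show ?thesis using add[OF S'(1) T'(1)] by blast
  qed
  then show "op_add p I S T \<in> op_closure p I W"
    using op_closure_iff[OF W] op_add_bounded[OF b] by blast
  have "\<exists>R\<in>W. \<forall>f\<in>L. N (\<lambda>x. op_mult p I S T f x - R f x) \<le> e * N f" if "0 < e" for e
  proof -
    \<comment> \<open>Since \<open>S T - S' T' = S (T - T') + (S - S') T'\<close>, the approximant
      \<open>T'\<close> is first chosen against the bound \<open>K\<close> of \<open>S\<close>; only
      then is its own bound \<open>M\<close> known, against which \<open>S'\<close> is
      chosen.\<close>
    obtain K where K: "0 \<le> K" "\<And>f. f \<in> L \<Longrightarrow> N (S f) \<le> K * N f" by (meson op_bound[OF b(1)])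
    obtain d where d: "0 < d" "K * d \<le> e / 2"
      using small_multiple_le[OF K(1), of "e / 2"] \<open>0 < e\<close> by auto
    obtain T' where T': "T' \<in> W" "T' \<in> bounded_ops p I"
      "\<And>f. f \<in> L \<Longrightarrow> N (\<lambda>x. T f x - T' f x) \<le> d * N f"
      using op_closure_approx[OF W ST(2) d(1)] by auto
    obtain M where M: "0 \<le> M" "\<And>f. f \<in> L \<Longrightarrow> N (T' f) \<le> M * N f" by (meson op_bound[OF T'(2)])
    obtain c where c: "0 < c" "c * M \<le> e / 2"
      using small_multiple_le[OF M(1), of "e / 2"] \<open>0 < e\<close> by (auto simp: mult.commute)
    obtain S' where S': "S' \<in> W" "S' \<in> bounded_ops p I"
      "\<And>f. f \<in> L \<Longrightarrow> N (\<lambda>x. S f x - S' f x) \<le> c * N f"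
      using op_closure_approx[OF W ST(1) c(1)] by auto
    have "N (\<lambda>x. op_mult p I S T f x - op_mult p I S' T' f x) \<le> e * N f" if f: "f \<in> L" for f
    proof -
      note Tf = op_in[OF b(2) f] and T'f = op_in[OF T'(2) f]
      have "N (\<lambda>x. S (T f) x - S (T' f) x) = N (S (\<lambda>x. T f x - T' f x))"
        by (simp add: op_subtractive[OF b(1) Tf T'f])
      also have "\<dots> \<le> K * N (\<lambda>x. T f x - T' f x)"
        by (rule K(2)[OF diff_in_ellp[OF Tf T'f]])
      also have "\<dots> \<le> K * (d * N f)"
        by (rule mult_left_mono[OF T'(3)[OF f] K(1)])
      also have "\<dots> \<le> e / 2 * N f"
        using mult_right_mono[OF d(2), of "N f"] by (simp add: mult.assoc)
      finally have 1: "N (\<lambda>x. S (T f) x - S (T' f) x) \<le> e / 2 * N f" .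
      have "N (\<lambda>x. S (T' f) x - S' (T' f) x) \<le> c * N (T' f)"
        by (rule S'(3)[OF T'f])
      also have "\<dots> \<le> c * (M * N f)"
        using M(2)[OF f] c(1) by (intro mult_left_mono) auto
      also have "\<dots> \<le> e / 2 * N f"
        using mult_right_mono[OF c(2), of "N f"] by (simp add: mult.assoc)
      finally have 2: "N (\<lambda>x. S (T' f) x - S' (T' f) x) \<le> e / 2 * N f" .
      show ?thesis
        using norm_diff_triangle[OF op_in[OF b(1) Tf] op_in[OF b(1) T'f] op_in[OF S'(2) T'f]] 1 2 f
        by (simp add: op_mult_def compose_def)
    qed
    then show ?thesis using mult[OF S'(1) T'(1)] by blast
  qed
  then show "op_mult p I S T \<in> op_closure p I W"
    using op_closure_iff[OF W] op_mult_bounded[OF b] by blast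
next
  fix c T assume T: "T \<in> op_closure p I W"
  then have b: "T \<in> bounded_ops p I" using op_closure_bounded by blast
  have "\<exists>R\<in>W. \<forall>f\<in>L. N (\<lambda>x. op_scale p I c T f x - R f x) \<le> e * N f" if "0 < e" for e
  proof -
    obtain d where d: "0 < d" "norm c * d \<le> e"
      using small_multiple_le[OF norm_ge_zero \<open>0 < e\<close>, of c] .
    obtain T' where T': "T' \<in> W" "T' \<in> bounded_ops p I"
      "\<And>f. f \<in> L \<Longrightarrow> N (\<lambda>x. T f x - T' f x) \<le> d * N f"
      using op_closure_approx[OF W T d(1)] by auto
    have "N (\<lambda>x. op_scale p I c T f x - op_scale p I c T' f x) \<le> e * N f" if f: "f \<in> L" for f
    proof -
      have "N (\<lambda>x. op_scale p I c T f x - op_scale p I c T' f x) = norm c * N (\<lambda>x. T f x - T' f x)"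
        using f by (simp add: op_scale_def right_diff_distrib flip: norm_scale)
      also have "\<dots> \<le> norm c * (d * N f)"
        using T'(3)[OF f] by (intro mult_left_mono) auto
      also have "\<dots> \<le> e * N f"
        using mult_right_mono[OF d(2), of "N f"] by (simp add: mult.assoc)
      finally show ?thesis .
    qed
    then show ?thesis using scale[OF T'(1)] by blast
  qed
  then show "op_scale p I c T \<in> op_closure p I W"
    using op_closure_iff[OF W] op_scale_bounded[OF b] by blast
qed

section \<open>Matrix rows, reindexing and unit vectors\<close>

text \<open>Finitely supported functions are handled by linearity. The part \<open>g\<close> of
  \<open>f\<close> outside \<open>K\<close> is a norm limit of finitely supported functions whose
  images vanish at \<open>s\<close>, so boundedness of \<open>T\<close> gives
  \<open>T g s = 0\<close>.\<close>

lemma op_row_finite: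
  assumes T: "T \<in> bounded_ops p I" and "finite K" "K \<subseteq> I" and f: "f \<in> L"
    and coeff: "\<And>t. t \<in> I \<Longrightarrow> t \<notin> K \<Longrightarrow> mat_coeff T s t = 0"
  shows "T f s = (\<Sum>t\<in>K. mat_coeff T s t * f t)"
proof -
  have fin: "T (\<lambda>x. if x \<in> F then f x else 0) s = (\<Sum>t\<in>F. mat_coeff T s t * f t)"
    if "finite F" "F \<subseteq> I" for F and f :: "'a \<Rightarrow> complex"
    using that
  proof (induction F)
    case empty
    then show ?case by (simp add: op_zero_arg[OF T])
  next
    case (insert t F)
    have eq: "(\<lambda>x. if x \<in> insert t F then f x else 0)
        = (\<lambda>x. f t * delta t x + (if x \<in> F then f x else 0))"
      using insert.hyps by (auto simp: delta_def)
    have "(\<lambda>x. if x \<in> F then f x else 0) \<in> L"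
      using insert by (intro ellp_finite_support) (auto simp: split: if_splits)
    then have "T (\<lambda>x. if x \<in> insert t F then f x else 0) s
        = f t * T (delta t) s + T (\<lambda>x. if x \<in> F then f x else 0) s"
      unfolding eq using insert.prems
      by (subst op_additive[OF T]) (auto simp: op_homogeneous[OF T] scale_in_ellp)
    then show ?case
      using insert by (simp add: mat_coeff_def)
  qed
  define g where "g = (\<lambda>x. if x \<in> K then 0 else f x)"
  have fK: "(\<lambda>x. if x \<in> K then f x else 0) \<in> L"
    using assms(2,3) by (auto intro!: ellp_finite_support split: if_splits)
  have g: "g \<in> L"
    using diff_in_ellp[OF f fK] unfolding g_def by (rule back_subst[of "\<lambda>h. h \<in> L"]) auto
  obtain C where C: "0 \<le> C" "\<And>f. f \<in> L \<Longrightarrow> N (T f) \<le> C * N f" by (meson op_bound[OF T])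
  have "norm (T g s) \<le> 0 + e" if "0 < e" for e
  proof -
    obtain d where d: "0 < d" "C * d \<le> e"
      using small_multiple_le[OF C(1) \<open>0 < e\<close>] .
    obtain F where F: "finite F" "F \<subseteq> I" "(\<lambda>x. if x \<in> F then 0 else g x) \<in> L"
      "N (\<lambda>x. if x \<in> F then 0 else g x) \<le> d"
      using norm_restrict_tail_small[OF g d(1)] .
    have gF: "(\<lambda>x. if x \<in> F then g x else 0) \<in> L"
      using F(1,2) by (auto intro!: ellp_finite_support split: if_splits)
    have "T g s = T (\<lambda>x. (if x \<in> F then g x else 0) + (if x \<in> F then 0 else g x)) s"
      by (rule arg_cong[where f = "\<lambda>f. T f s"]) auto
    also have "\<dots> = (\<Sum>t\<in>F. mat_coeff T s t * g t) + T (\<lambda>x. if x \<in> F then 0 else g x) s"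
      using fin[OF F(1,2)] by (simp add: op_additive[OF T gF F(3)])
    \<comment> \<open>Each term vanishes: \<open>g t = 0\<close> for \<open>t\<close> in
      \<open>K\<close>, and the coefficient is 0 outside \<open>K\<close>.\<close>
    also have "(\<Sum>t\<in>F. mat_coeff T s t * g t) = 0"
      using coeff F(2) by (intro sum.neutral) (auto simp: g_def)
    finally have "norm (T g s) \<le> N (T (\<lambda>x. if x \<in> F then 0 else g x))"
      using norm_component_le[OF op_in[OF T F(3)]] by simp
    also have "\<dots> \<le> C * d"
      using C(2)[OF F(3)] mult_left_mono[OF F(4) C(1)] by simp
    finally show ?thesis using d by simp
  qed
  then have "T g s = 0"
    by (metis field_le_epsilon norm_le_zero_iff)
  moreover have "T f s = T (\<lambda>x. (if x \<in> K then f x else 0) + g x) s"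
    by (rule arg_cong[where f = "\<lambda>f. T f s"]) (auto simp: g_def)
  ultimately show ?thesis
    using fin[OF assms(2,3)] by (simp add: op_additive[OF T fK g])
qed

text \<open>A permutation of the index set only rearranges the sum that defines the norm. Left and
  right translations of a group are the instances needed.\<close>

lemma
  assumes \<phi>: "bij_betw \<phi> I I" and f: "f \<in> L"
  shows reindex_in_ellp: "(\<lambda>t. if t \<in> I then f (\<phi> t) else 0) \<in> L"
    and norm_reindex: "N (\<lambda>t. if t \<in> I then f (\<phi> t) else 0) = N f"
proof -
  have "(\<lambda>t. norm (if t \<in> I then f (\<phi> t) else 0) powr p) summable_on I
      \<longleftrightarrow> (\<lambda>t. norm (f (\<phi> t)) powr p) summable_on I"
    by (rule summable_on_cong) simp
  also have "\<dots> \<longleftrightarrow> (\<lambda>x. norm (f x) powr p) summable_on I"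
    by (rule summable_on_reindex_bij_betw[OF \<phi>])
  finally show "(\<lambda>t. if t \<in> I then f (\<phi> t) else 0) \<in> L"
    using f by (simp add: ellp_def)
  have "(\<Sum>\<^sub>\<infinity>t\<in>I. norm (if t \<in> I then f (\<phi> t) else 0) powr p)
      = (\<Sum>\<^sub>\<infinity>t\<in>I. norm (f (\<phi> t)) powr p)"
    by (rule infsum_cong) simp
  also have "\<dots> = (\<Sum>\<^sub>\<infinity>x\<in>I. norm (f x) powr p)"
    by (rule infsum_reindex_bij_betw[OF \<phi>])
  finally show "N (\<lambda>t. if t \<in> I then f (\<phi> t) else 0) = N f"
    by (simp add: ellp_norm_def)
qed

lemma norm_delta_le: "t \<in> I \<Longrightarrow> N (delta t) \<le> 1"
proof (rule norm_leI)
  fix F :: "'a set" assume "finite F"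
  have "norm (delta t x :: complex) powr p = (if x = t then 1 else 0)" for x
    by (simp add: delta_def)
  then show "(\<Sum>x\<in>F. norm (delta t x) powr p) \<le> 1 powr p"
    using \<open>finite F\<close> by simp
qed auto

end

section \<open>Invariant means\<close>

lemma ell_inftyI:
  assumes "\<And>x. x \<in> I \<Longrightarrow> norm (f x) \<le> B" "\<And>x. x \<notin> I \<Longrightarrow> f x = 0"
  shows "f \<in> ell_infty I"
  using assms by (auto simp: ell_infty_def bounded_iff)

lemma ell_inftyE:
  assumes "f \<in> ell_infty I"
  obtains B where "\<And>x. norm (f x) \<le> B" "\<And>x. x \<notin> I \<Longrightarrow> f x = 0"
proof -
  obtain B where B: "\<forall>x\<in>I. norm (f x) \<le> B" and 0: "\<forall>x. x \<notin> I \<longrightarrow> f x = 0"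
    using assms by (auto simp: ell_infty_def bounded_iff)
  \<comment> \<open>Outside \<open>I\<close> the function is 0, while \<open>B\<close> may be
    negative if \<open>I\<close> is empty.\<close>
  have "norm (f x) \<le> max B 0" for x
    using B 0 by (cases "x \<in> I") (auto simp: le_max_iff_disj)
  then show thesis using that[of "max B 0"] 0 by auto
qed

lemma ell_infty_add:
  assumes "f \<in> ell_infty I" "g \<in> ell_infty I"
  shows "(\<lambda>x. f x + g x) \<in> ell_infty I"
proof -
  obtain A B where "\<And>x. norm (f x) \<le> A" "\<And>x. norm (g x) \<le> B"
    using assms by (meson ell_inftyE)
  then have "norm (f x + g x) \<le> A + B" for x
    by (meson add_mono norm_triangle_ineq order_trans)
  then show ?thesis using assms by (intro ell_inftyI) (auto simp: ell_infty_def)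
qed

lemma ell_infty_scale:
  assumes "f \<in> ell_infty I"
  shows "(\<lambda>x. c * f x) \<in> ell_infty I"
proof -
  obtain B where "\<And>x. norm (f x) \<le> B"
    using assms by (meson ell_inftyE)
  then have "norm (c * f x) \<le> norm c * B" for x
    by (simp add: norm_mult mult_left_mono)
  then show ?thesis using assms by (intro ell_inftyI) (auto simp: ell_infty_def)
qed

lemma ell_infty_indicator: "indicator I \<in> ell_infty I"
  by (rule ell_inftyI[where B = 1]) auto

lemma ell_infty_sum:
  assumes "\<And>h. h \<in> F \<Longrightarrow> u h \<in> ell_infty I"
  shows "(\<lambda>x. \<Sum>h\<in>F. u h x) \<in> ell_infty I"
  using assms
proof (induction F rule: infinite_finite_induct)
  case (insert h F)
  then show ?case using ell_infty_add[of "u h" I "\<lambda>x. \<Sum>h\<in>F. u h x"] by simp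
qed (auto intro!: ell_inftyI[where B = 0])

section \<open>Linearity, positivity and Jensen's inequality for the mean\<close>

context
  fixes G :: "('a, 'b) monoid_scheme" and m :: "('a \<Rightarrow> complex) \<Rightarrow> complex"
  assumes m: "invariant_mean G m"
begin

lemma
  shows mean_add: "f \<in> ell_infty (carrier G) \<Longrightarrow> g \<in> ell_infty (carrier G) \<Longrightarrow> m (\<lambda>x. f x + g x) = m f + m g"
    and mean_scale: "f \<in> ell_infty (carrier G) \<Longrightarrow> m (\<lambda>x. c * f x) = c * m f"
    and mean_nonneg: "f \<in> ell_infty (carrier G) \<Longrightarrow> (\<And>x. x \<in> carrier G \<Longrightarrow> f x \<in> \<real>\<^sub>\<ge>\<^sub>0) \<Longrightarrow> m f \<in> \<real>\<^sub>\<ge>\<^sub>0"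
    and mean_indicator: "m (indicator (carrier G)) = 1"
    and mean_left_translate: "s \<in> carrier G \<Longrightarrow> f \<in> ell_infty (carrier G) \<Longrightarrow> m (left_translate G s f) = m f"
  using m unfolding invariant_mean_def by blast+

lemma mean_sum:
  assumes "\<And>h. h \<in> F \<Longrightarrow> u h \<in> ell_infty (carrier G)"
  shows "m (\<lambda>x. \<Sum>h\<in>F. u h x) = (\<Sum>h\<in>F. m (u h))"
proof -
  \<comment> \<open>This settles the empty set and also infinite \<open>F\<close>, where both sums
    are 0 by convention.\<close>
  have z: "m (\<lambda>x. 0) = 0"
    using mean_scale[OF ell_infty_indicator, of 0] by simp
  show ?thesis
    using assms
  proof (induction F rule: infinite_finite_induct)
    case (insert h F)
    have "(\<lambda>x. \<Sum>h\<in>F. u h x) \<in> ell_infty (carrier G)"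
      using insert.prems by (intro ell_infty_sum) auto
    then show ?case
      using insert mean_add[of "u h" "\<lambda>x. \<Sum>h\<in>F. u h x"] by simp
  qed (simp_all add: z)
qed

text \<open>On the carrier \<open>w = C - v + \<i> * y\<close> with \<open>v = C - Re w\<close>
  nonnegative and \<open>y = Im w\<close> real. Positivity makes \<open>m v\<close> nonnegative, and
  it remains to see that \<open>m y\<close> is real.\<close>

lemma mean_Re_le:
  assumes w: "w \<in> ell_infty (carrier G)" and C: "\<And>x. x \<in> carrier G \<Longrightarrow> Re (w x) \<le> C"
  shows "Re (m w) \<le> C"
proof -
  obtain B where B: "\<And>x. norm (w x) \<le> B" and 0: "\<And>x. x \<notin> carrier G \<Longrightarrow> w x = 0"
    using ell_inftyE[OF w] by blast
  define one :: "'a \<Rightarrow> complex" where "one = indicator (carrier G)"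
  define v where "v = (\<lambda>x. complex_of_real C * one x + (-1) * complex_of_real (Re (w x)))"
  define y where "y = (\<lambda>x. complex_of_real (Im (w x)))"
  have one: "one \<in> ell_infty (carrier G)" "m one = 1"
    unfolding one_def by (rule ell_infty_indicator) (rule mean_indicator)
  have re: "(\<lambda>x. complex_of_real (Re (w x))) \<in> ell_infty (carrier G)"
    using order_trans[OF abs_Re_le_cmod B] by (intro ell_inftyI[where B = B]) (auto simp: 0)
  have y: "y \<in> ell_infty (carrier G)"
    using order_trans[OF abs_Im_le_cmod B] unfolding y_def
    by (intro ell_inftyI[where B = B]) (auto simp: 0)
  have v: "v \<in> ell_infty (carrier G)"
    unfolding v_def by (intro ell_infty_add ell_infty_scale one re)
  have "m v \<in> \<real>\<^sub>\<ge>\<^sub>0"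
    by (rule mean_nonneg[OF v]) (auto simp: v_def one_def C complex_nonneg_Reals_iff)
  \<comment> \<open>Positivity speaks only of nonnegative functions: adding the constant
    \<open>B\<close> makes \<open>y\<close> nonnegative, and subtracting it again shows that
    \<open>m y\<close> is real.\<close>
  have "m (\<lambda>x. y x + complex_of_real B * one x) \<in> \<real>\<^sub>\<ge>\<^sub>0"
  proof (rule mean_nonneg)
    fix x assume "x \<in> carrier G"
    have "- B \<le> Im (w x)" using order_trans[OF abs_Im_le_cmod B, of x] by simp
    then show "y x + complex_of_real B * one x \<in> \<real>\<^sub>\<ge>\<^sub>0"
      using \<open>x \<in> carrier G\<close> by (simp add: y_def one_def complex_nonneg_Reals_iff)
  qed (intro ell_infty_add ell_infty_scale one y)
  then have "Im (m y) = 0"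
    using one by (simp add: mean_add y ell_infty_scale mean_scale complex_nonneg_Reals_iff)
  have "w = (\<lambda>x. (complex_of_real C * one x + (-1) * v x) + \<i> * y x)"
    unfolding v_def y_def by (auto simp: complex_eq_iff)
  then have "m w = complex_of_real C - m v + \<i> * m y"
    using one mean_scale[OF v, of "-1"]
    by (simp only: mean_add mean_scale ell_infty_add ell_infty_scale v y) simp
  then show ?thesis
    using \<open>m v \<in> \<real>\<^sub>\<ge>\<^sub>0\<close> \<open>Im (m y) = 0\<close> by (simp add: complex_nonneg_Reals_iff)
qed

text \<open>Replacing \<open>t powr p\<close> by its tangent lines at the points \<open>norm (m (u x))\<close> leaves the real part
  of a function linear in \<open>u\<close>, to which the mean can be applied directly.\<close>

lemma mean_Jensen:
  assumes "1 < p" and u: "\<And>x. x \<in> F \<Longrightarrow> u x \<in> ell_infty (carrier G)"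
    and C: "\<And>g. g \<in> carrier G \<Longrightarrow> (\<Sum>x\<in>F. norm (u x g) powr p) \<le> C"
  shows "(\<Sum>x\<in>F. norm (m (u x)) powr p) \<le> C"
proof -
  define M where "M x = norm (m (u x))" for x
  \<comment> \<open>The factor \<open>c x\<close>, unimodular or 0 when the mean vanishes, rotates
    \<open>m (u x)\<close> to its modulus \<open>M x\<close>, so that the modulus becomes linear in
    \<open>u x\<close>.\<close>
  define c where "c x = cnj (sgn (m (u x)))" for x
  define one :: "'a \<Rightarrow> complex" where "one = indicator (carrier G)"
  \<comment> \<open>The tangent at \<open>M x\<close> is evaluated at \<open>c x * u x g\<close>.
    Its mean is exactly \<open>M x powr p\<close>, while its real part stays below
    \<open>norm (u x g) powr p\<close>. The factor \<open>one\<close> makes the constant term vanish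
    off the carrier.\<close>
  define w where "w x g = complex_of_real (M x powr p - p * M x powr (p - 1) * M x) * one g
      + (complex_of_real (p * M x powr (p - 1)) * c x) * u x g" for x g
  have one: "one \<in> ell_infty (carrier G)" "m one = 1"
    unfolding one_def by (rule ell_infty_indicator) (rule mean_indicator)
  have norm_c: "norm (c x) \<le> 1" for x
    by (simp add: c_def norm_sgn)
  have c: "c x * m (u x) = complex_of_real (M x)" for x
    unfolding c_def M_def sgn_eq
    by (auto simp: complex_norm_square[symmetric] mult.commute[of "cnj _"] power2_eq_square)
  have w: "w x \<in> ell_infty (carrier G)" if "x \<in> F" for x
    unfolding w_def by (intro ell_infty_add ell_infty_scale one u that)
  have mw: "m (w x) = complex_of_real (M x powr p)" if "x \<in> F" for x
    unfolding w_def using one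
    by (subst mean_add) (auto simp: mean_scale u that ell_infty_scale c mult.assoc)
  have "Re (m (\<lambda>g. \<Sum>x\<in>F. w x g)) \<le> C"
  proof (rule mean_Re_le)
    fix g assume g: "g \<in> carrier G"
    have "Re (w x g) \<le> norm (u x g) powr p" for x
    proof -
      have "Re (c x * u x g) \<le> norm (c x) * norm (u x g)"
        using complex_Re_le_cmod[of "c x * u x g"] by (simp add: norm_mult)
      also have "\<dots> \<le> 1 * norm (u x g)"
        using norm_c by (intro mult_right_mono) auto
      finally have "p * M x powr (p - 1) * Re (c x * u x g) \<le> p * M x powr (p - 1) * norm (u x g)"
        using \<open>1 < p\<close> by (intro mult_left_mono) auto
      moreover have "Re (w x g) = M x powr p - p * M x powr (p - 1) * M x + p * M x powr (p - 1) * Re (c x * u x g)"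
        using g by (simp add: w_def one_def mult.assoc)
      moreover have "M x powr p + p * M x powr (p - 1) * (norm (u x g) - M x) \<le> norm (u x g) powr p"
        using \<open>1 < p\<close> by (intro powr_above_tangent) (auto simp: M_def)
      ultimately show ?thesis by (simp add: right_diff_distrib)
    qed
    then have "Re (\<Sum>x\<in>F. w x g) \<le> (\<Sum>x\<in>F. norm (u x g) powr p)"
      by (simp add: sum_mono)
    then show "Re (\<Sum>x\<in>F. w x g) \<le> C" using C[OF g] by simp
  qed (intro ell_infty_sum w)
  then show ?thesis
    by (simp add: mean_sum w mw M_def)
qed

end

section \<open>Translation-invariant operators\<close>

locale metric_group = group G for G (structure) +
  fixes d :: "'a \<Rightarrow> 'a \<Rightarrow> real" and p :: real
  assumes d: "proper_right_invariant_metric G d" and p: "1 < p"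

sublocale metric_group \<subseteq> ellp_space p "carrier G"
  by standard (rule p)

context metric_group
begin

lemma metric: "Metric_space (carrier G) d"
  using d by (simp add: proper_right_invariant_metric_def)

lemma d_nonneg: "0 \<le> d s t"
  by (rule Metric_space.nonneg[OF metric])

lemma d_right_invariant:
  "s \<in> carrier G \<Longrightarrow> t \<in> carrier G \<Longrightarrow> g \<in> carrier G \<Longrightarrow> d (s \<otimes> g) (t \<otimes> g) = d s t"
  using d by (simp add: proper_right_invariant_metric_def)

text \<open>Properness of the metric enters here. By right invariance this ball consists of the
  quotients \<open>s \<otimes> inv t\<close> of all pairs at distance at most
  \<open>r\<close>.\<close>

lemma finite_ball_one: "finite {h \<in> carrier G. d h \<one> \<le> r}"
proof -
  have "{h \<in> carrier G. d h \<one> \<le> r} \<subseteq> Metric_space.mcball (carrier G) d \<one> r"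
    by (auto simp: Metric_space.mcball_def[OF metric] Metric_space.commute[OF metric])
  then show ?thesis
    using d finite_subset unfolding proper_right_invariant_metric_def by blast
qed

section \<open>Left and right translations as isometries\<close>

lemma
  assumes s: "s \<in> carrier G" and f: "f \<in> L"
  shows left_translate_in_ellp: "left_translate G s f \<in> L"
    and norm_left_translate: "N (left_translate G s f) = N f"
proof -
  have "bij_betw (\<lambda>t. inv s \<otimes> t) (carrier G) (carrier G)"
    by (rule bij_betw_byWitness[where f' = "\<lambda>t. s \<otimes> t"]) (use s in \<open>auto simp: m_assoc[symmetric]\<close>)
  from reindex_in_ellp[OF this f] norm_reindex[OF this f]
  show "left_translate G s f \<in> L" "N (left_translate G s f) = N f"
    unfolding left_translate_def by auto
qed

lemma
  assumes s: "s \<in> carrier G" and f: "f \<in> L"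
  shows right_translate_in_ellp: "right_translate G s f \<in> L"
    and norm_right_translate: "N (right_translate G s f) = N f"
proof -
  have "bij_betw (\<lambda>t. t \<otimes> s) (carrier G) (carrier G)"
    by (rule bij_betw_byWitness[where f' = "\<lambda>t. t \<otimes> inv s"]) (use s in \<open>auto simp: m_assoc\<close>)
  from reindex_in_ellp[OF this f] norm_reindex[OF this f]
  show "right_translate G s f \<in> L" "N (right_translate G s f) = N f"
    unfolding right_translate_def by auto
qed

lemma left_regular_bounded:
  assumes "s \<in> carrier G"
  shows "left_regular p G s \<in> bounded_ops p (carrier G)"
proof (rule bounded_opsI[where K = 1])
  show "left_regular p G s \<in> extensional L" by (simp add: left_regular_def)
qed (auto simp: left_regular_def left_translate_in_ellp[OF assms] norm_left_translate[OF assms]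
    add_in_ellp scale_in_ellp, auto simp: left_translate_def)

section \<open>The algebra of finitely supported convolutions\<close>

text \<open>This is the image under the left regular representation of the group algebra element
  with coefficients \<open>a h\<close> for \<open>h\<close> in \<open>F\<close>; values of
  \<open>a\<close> outside \<open>F\<close> are ignored, so finiteness is a condition on
  \<open>F\<close> alone.\<close>

definition convolution :: "'a set \<Rightarrow> ('a \<Rightarrow> complex) \<Rightarrow> 'a operator" where
  "convolution F a = (\<lambda>f\<in>L. \<lambda>t. \<Sum>h\<in>F. a h * left_translate G h f t)"

definition convolutions :: "'a operator set" where
  "convolutions = {convolution F a |F a. finite F \<and> F \<subseteq> carrier G}"

text \<open>A convolution is a linear combination of left translations. The set \<open>V\<close> is
  arbitrary, so that the rule serves for boundedness, for products and for the minimality of the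
  hull.\<close>

lemma convolution_induct:
  assumes "finite F" "F \<subseteq> carrier G"
    and "\<And>h. h \<in> carrier G \<Longrightarrow> left_regular p G h \<in> V"
    and "op_zero p (carrier G) \<in> V"
    and "\<And>S T. S \<in> V \<Longrightarrow> T \<in> V \<Longrightarrow> op_add p (carrier G) S T \<in> V"
    and "\<And>c T. T \<in> V \<Longrightarrow> op_scale p (carrier G) c T \<in> V"
  shows "convolution F a \<in> V"
  using assms(1,2)
proof (induction F)
  case empty
  then show ?case using assms(4) by (simp add: convolution_def op_zero_def restrict_def)
next
  case (insert h F)
  have "convolution (insert h F) a
      = op_add p (carrier G) (op_scale p (carrier G) (a h) (left_regular p G h)) (convolution F a)"
    using insert.hyps by (auto simp: convolution_def op_add_def op_scale_def left_regular_def restrict_def)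
  then show ?case using insert by (simp add: assms)
qed

lemma convolutions_bounded: "convolutions \<subseteq> bounded_ops p (carrier G)"
  unfolding convolutions_def
  by (auto intro!: convolution_induct left_regular_bounded op_zero_bounded op_add_bounded op_scale_bounded)

lemma left_regular_in_convolutions:
  assumes "h \<in> carrier G"
  shows "left_regular p G h \<in> convolutions"
proof -
  have "left_regular p G h = convolution {h} (\<lambda>_. 1)"
    by (auto simp: left_regular_def convolution_def)
  then show ?thesis using assms unfolding convolutions_def by blast
qed

lemma convolutions_zero: "op_zero p (carrier G) \<in> convolutions"
proof -
  have "op_zero p (carrier G) = convolution {} (\<lambda>_. 0)"
    by (simp add: convolution_def op_zero_def)
  then show ?thesis unfolding convolutions_def by blast
qed

lemma convolutions_scale:
  assumes "T \<in> convolutions"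
  shows "op_scale p (carrier G) c T \<in> convolutions"
proof -
  obtain F a where F: "finite F" "F \<subseteq> carrier G" and T: "T = convolution F a"
    using assms by (auto simp: convolutions_def)
  have "op_scale p (carrier G) c T = convolution F (\<lambda>h. c * a h)"
    unfolding T by (auto simp: convolution_def op_scale_def sum_distrib_left mult.assoc)
  then show ?thesis using F unfolding convolutions_def by blast
qed

lemma convolutions_add:
  assumes "S \<in> convolutions" "T \<in> convolutions"
  shows "op_add p (carrier G) S T \<in> convolutions"
proof -
  obtain F a where F: "finite F" "F \<subseteq> carrier G" and S: "S = convolution F a"
    using assms by (auto simp: convolutions_def)
  obtain H b where H: "finite H" "H \<subseteq> carrier G" and T: "T = convolution H b"
    using assms by (auto simp: convolutions_def)
  \<comment> \<open>Extension by zero lets both sums run over \<open>F \<union> H\<close>.\<close>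
  define a' where "a' h = (if h \<in> F then a h else 0)" for h
  define b' where "b' h = (if h \<in> H then b h else 0)" for h
  have "S = convolution (F \<union> H) a'"
    unfolding S convolution_def using F H
    by (intro restrict_ext ext sum.mono_neutral_cong_left) (auto simp: a'_def)
  moreover have "T = convolution (F \<union> H) b'"
    unfolding T convolution_def using F H
    by (intro restrict_ext ext sum.mono_neutral_cong_left) (auto simp: b'_def)
  ultimately have "op_add p (carrier G) S T = convolution (F \<union> H) (\<lambda>h. a' h + b' h)"
    by (auto simp: convolution_def op_add_def sum.distrib distrib_right)
  moreover have "finite (F \<union> H)" "F \<union> H \<subseteq> carrier G" using F H by auto
  ultimately show ?thesis unfolding convolutions_def by blast
qed

text \<open>Translating by \<open>k\<close> and then by \<open>h\<close> is translating by
  \<open>h \<otimes> k\<close>, so the coefficients are reindexed along the injective map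
  \<open>k \<mapsto> h \<otimes> k\<close>.\<close>

lemma left_regular_mult_convolution:
  assumes h: "h \<in> carrier G" and F: "F \<subseteq> carrier G"
  shows "op_mult p (carrier G) (left_regular p G h) (convolution F b)
    = convolution ((\<lambda>k. h \<otimes> k) ` F) (\<lambda>k. b (inv h \<otimes> k))"
proof -
  have "left_translate G h (\<lambda>t. \<Sum>k\<in>F. b k * left_translate G k f t) t
      = (\<Sum>k\<in>(\<lambda>k. h \<otimes> k) ` F. b (inv h \<otimes> k) * left_translate G k f t)" for f t
  proof (cases "t \<in> carrier G")
    case True
    have inj: "inj_on (\<lambda>k. h \<otimes> k) F"
      using h F by (auto intro!: inj_onI simp: subset_iff)
    have "b (inv h \<otimes> (h \<otimes> k)) * left_translate G (h \<otimes> k) f t = b k * f (inv k \<otimes> (inv h \<otimes> t))"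
      if "k \<in> F" for k
    proof -
      have "k \<in> carrier G" using that F by auto
      then show ?thesis
        using h True by (simp add: left_translate_def inv_mult_group m_assoc[symmetric])
    qed
    then show ?thesis
      using h True unfolding sum.reindex[OF inj] o_def
      by (simp add: left_translate_def)
  qed (simp add: left_translate_def)
  moreover have "convolution F b f \<in> L" if "f \<in> L" for f
    using that F unfolding convolution_def
    by (auto intro!: sum_in_ellp scale_in_ellp left_translate_in_ellp)
  ultimately show ?thesis
    unfolding op_mult_def compose_def left_regular_def convolution_def
    by (intro restrict_ext ext) simp
qed

text \<open>With \<open>T\<close> fixed, the product is linear in the left factor, so
  \<open>convolution_induct\<close> reduces the claim to a single left translation.\<close>

lemma convolutions_mult:
  assumes "S \<in> convolutions" "T \<in> convolutions"
  shows "op_mult p (carrier G) S T \<in> convolutions"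
proof -
  obtain F a where F: "finite F" "F \<subseteq> carrier G" and S: "S = convolution F a"
    using assms by (auto simp: convolutions_def)
  have TL: "T f \<in> L" if "f \<in> L" for f
    using assms(2) convolutions_bounded op_in that by blast
  have "convolution F a \<in> {S. op_mult p (carrier G) S T \<in> convolutions}"
    using F
  proof (rule convolution_induct)
    fix h assume h: "h \<in> carrier G"
    obtain H b where H: "finite H" "H \<subseteq> carrier G" and T: "T = convolution H b"
      using assms by (auto simp: convolutions_def)
    have "finite ((\<lambda>k. h \<otimes> k) ` H)" "(\<lambda>k. h \<otimes> k) ` H \<subseteq> carrier G"
      using H h by auto
    then show "left_regular p G h \<in> {S. op_mult p (carrier G) S T \<in> convolutions}"
      unfolding mem_Collect_eq T left_regular_mult_convolution[OF h H(2)]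
      unfolding convolutions_def by blast
  next
    have "op_mult p (carrier G) (op_zero p (carrier G)) T = op_zero p (carrier G)"
      by (auto simp: op_mult_def op_zero_def compose_def TL)
    then show "op_zero p (carrier G) \<in> {S. op_mult p (carrier G) S T \<in> convolutions}"
      by (simp add: convolutions_zero)
  next
    fix R S
    have "op_mult p (carrier G) (op_add p (carrier G) R S) T
        = op_add p (carrier G) (op_mult p (carrier G) R T) (op_mult p (carrier G) S T)"
      by (auto simp: op_mult_def op_add_def compose_def TL)
    moreover assume "R \<in> {S. op_mult p (carrier G) S T \<in> convolutions}"
      "S \<in> {S. op_mult p (carrier G) S T \<in> convolutions}"
    ultimately show "op_add p (carrier G) R S \<in> {S. op_mult p (carrier G) S T \<in> convolutions}"
      by (simp add: convolutions_add)
  next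
    fix c S
    have "op_mult p (carrier G) (op_scale p (carrier G) c S) T
        = op_scale p (carrier G) c (op_mult p (carrier G) S T)"
      by (auto simp: op_mult_def op_scale_def compose_def TL)
    moreover assume "S \<in> {S. op_mult p (carrier G) S T \<in> convolutions}"
    ultimately show "op_scale p (carrier G) c S \<in> {S. op_mult p (carrier G) S T \<in> convolutions}"
      by (simp add: convolutions_scale)
  qed
  then show ?thesis by (simp add: S)
qed

text \<open>The convolutions already form an algebra, so their closure is a closed subalgebra. Any
  closed subalgebra containing the left translations contains the convolutions by linearity, and
  hence their closure.\<close>

lemma reduced_group_algebra_eq: "reduced_group_algebra p G = op_closure p (carrier G) convolutions"
  unfolding reduced_group_algebra_def
proof (rule hull_unique)
  show "left_regular p G ` carrier G \<subseteq> op_closure p (carrier G) convolutions"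
    using subset_op_closure[OF convolutions_bounded] left_regular_in_convolutions by auto
  show "closed_subalgebra p (carrier G) (op_closure p (carrier G) convolutions)"
    by (intro closed_subalgebra_op_closure convolutions_bounded convolutions_zero
        convolutions_add convolutions_scale convolutions_mult)
  fix V assume lam: "left_regular p G ` carrier G \<subseteq> V" and V: "closed_subalgebra p (carrier G) V"
  have "convolutions \<subseteq> V"
    using lam V unfolding convolutions_def closed_subalgebra_def
    by (auto intro!: convolution_induct)
  then show "op_closure p (carrier G) convolutions \<subseteq> V"
    using V op_closure_mono unfolding closed_subalgebra_def by blast
qed

section \<open>Propagation of convolutions and invariance of their limits\<close>

text \<open>A nonzero coefficient at \<open>s\<close>, \<open>t\<close> forces
  \<open>s = h \<otimes> t\<close> for some \<open>h\<close> in \<open>F\<close>, and right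
  invariance then gives \<open>d s t = d h \<one>\<close>.\<close>

lemma convolution_finite_propagation:
  assumes "finite F" "F \<subseteq> carrier G"
  shows "propagation (carrier G) d (convolution F a) < \<infinity>"
proof -
  \<comment> \<open>The sum of the distances replaces their maximum, so that empty \<open>F\<close>
    needs no separate case.\<close>
  have "propagation (carrier G) d (convolution F a) \<le> ennreal (\<Sum>h\<in>F. d h \<one>)"
    unfolding propagation_def
  proof (rule Sup_least, clarify)
    fix s t assume s: "s \<in> carrier G" and t: "t \<in> carrier G"
      and "mat_coeff (convolution F a) s t \<noteq> 0"
    then obtain h where h: "h \<in> F" "delta t (inv h \<otimes> s) \<noteq> (0 :: complex)"
      by (auto simp: mat_coeff_def convolution_def left_translate_def elim!: sum.not_neutral_contains_not_neutral)
    then have hG: "h \<in> carrier G" and "t = inv h \<otimes> s"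
      using assms by (auto simp: delta_def split: if_splits)
    then have "s = h \<otimes> t" using s by (simp add: m_assoc[symmetric])
    then have "d s t = d h \<one>"
      using d_right_invariant[OF hG one_closed t] t by simp
    also have "\<dots> \<le> (\<Sum>h\<in>F. d h \<one>)"
      using assms h d_nonneg by (intro member_le_sum) auto
    finally show "ennreal (d s t) \<le> ennreal (\<Sum>h\<in>F. d h \<one>)"
      by (rule ennreal_leI)
  qed
  then show ?thesis
    using ennreal_less_top le_less_trans infinity_ennreal_def by metis
qed

text \<open>Both operators are \<open>undefined\<close> outside \<open>L\<close>, so their equality
  is decided on \<open>L\<close>, where the conjugation unfolds to translations.\<close>

lemma Ad_right_regular_fixed_iff:
  assumes T: "T \<in> bounded_ops p (carrier G)" and g: "g \<in> carrier G"
  shows "Ad_right_regular p G g T = T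
    \<longleftrightarrow> (\<forall>f\<in>L. right_translate G g (T (right_translate G (inv g) f)) = T f)"
proof -
  have Ad: "Ad_right_regular p G g T
      = (\<lambda>f\<in>L. right_translate G g (T (right_translate G (inv g) f)))"
    using g T by (auto simp: Ad_right_regular_def op_mult_def right_regular_def compose_def restrict_def
        right_translate_in_ellp op_in)
  show ?thesis
    unfolding Ad using op_ext[OF T] by (auto simp: extensional_def fun_eq_iff[where f = "restrict _ _"])
qed

text \<open>Left and right translations commute by associativity.\<close>

lemma convolution_right_translate:
  assumes "T \<in> convolutions" "g \<in> carrier G" "f \<in> L" "t \<in> carrier G"
  shows "T (right_translate G g f) t = T f (t \<otimes> g)"
proof -
  obtain F a where F: "finite F" "F \<subseteq> carrier G" and T: "T = convolution F a"
    using assms by (auto simp: convolutions_def)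
  have "a h * left_translate G h (right_translate G g f) t = a h * left_translate G h f (t \<otimes> g)"
    if "h \<in> F" for h
  proof -
    have "h \<in> carrier G" using that F by auto
    then show ?thesis
      using assms by (simp add: left_translate_def right_translate_def m_assoc)
  qed
  then show ?thesis
    using assms(2,3) unfolding T
    by (auto simp: convolution_def right_translate_in_ellp simp del: mult_cancel_left intro!: sum.cong)
qed

text \<open>Convolutions commute with right translations, and evaluation at a point is continuous
  for the norm, so invariance survives the limit.\<close>

lemma op_closure_convolutions_invariant:
  assumes T: "T \<in> op_closure p (carrier G) convolutions" and g: "g \<in> carrier G"
  shows "Ad_right_regular p G g T = T"
proof -
  have Tb: "T \<in> bounded_ops p (carrier G)" using T op_closure_bounded by blast
  have "right_translate G g (T (right_translate G (inv g) f)) t = T f t" if f: "f \<in> L" for f t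
  proof (cases "t \<in> carrier G")
    case t: True
    define f' where "f' = right_translate G (inv g) f"
    have f': "f' \<in> L" "N f' = N f"
      using g f by (simp_all add: f'_def right_translate_in_ellp norm_right_translate)
    have "norm (T f' (t \<otimes> g) - T f t) \<le> 0 + e" if "0 < e" for e
    proof -
      \<comment> \<open>The approximation is used at \<open>f'\<close> and at \<open>f\<close>, both
        of norm \<open>N f\<close>, at a total cost of \<open>2 * N f * c\<close>.\<close>
      obtain c where c: "0 < c" "2 * N f * c \<le> e"
        using small_multiple_le[of "2 * N f" e] \<open>0 < e\<close> by auto
      obtain S where S: "S \<in> convolutions" "S \<in> bounded_ops p (carrier G)"
        "\<And>f. f \<in> L \<Longrightarrow> N (\<lambda>x. T f x - S f x) \<le> c * N f"
        using op_closure_approx[OF convolutions_bounded T c(1)] by blast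
      have close: "norm (T h x - S h x) \<le> c * N h" if "h \<in> L" for h x
        using norm_component_le[OF diff_in_ellp[OF op_in[OF Tb that] op_in[OF S(2) that]], of x] S(3)[OF that]
        by simp
      have "S f' (t \<otimes> g) = S f t"
        using convolution_right_translate[OF S(1), of "inv g" f "t \<otimes> g"] f g t
        by (simp add: f'_def m_assoc)
      then have "norm (T f' (t \<otimes> g) - T f t) \<le> norm (T f' (t \<otimes> g) - S f' (t \<otimes> g)) + norm (T f t - S f t)"
        using norm_triangle_ineq4[of "T f' (t \<otimes> g) - S f' (t \<otimes> g)" "T f t - S f t"] by simp
      also have "\<dots> \<le> c * N f + c * N f"
        using close[OF f'(1), of "t \<otimes> g"] close[OF f, of t] f'(2) by simp
      finally show ?thesis using c(2) by (simp add: mult.commute)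
    qed
    then have "T f' (t \<otimes> g) = T f t"
      by (metis field_le_epsilon norm_le_zero_iff right_minus_eq)
    then show ?thesis using t by (simp add: right_translate_def f'_def)
  next
    case False
    then show ?thesis using ellp_outside[OF op_in[OF Tb f] False] by (simp add: right_translate_def)
  qed
  then show ?thesis unfolding Ad_right_regular_fixed_iff[OF Tb g] by blast
qed

lemma reduced_group_algebra_subset: "reduced_group_algebra p G \<subseteq> invariant_uniform_Roe p G d"
proof -
  have "convolutions \<subseteq> {T \<in> bounded_ops p (carrier G). propagation (carrier G) d T < \<infinity>}"
    using convolutions_bounded convolution_finite_propagation unfolding convolutions_def by blast
  then show ?thesis
    unfolding reduced_group_algebra_eq invariant_uniform_Roe_def uniform_Roe_def
    using op_closure_mono op_closure_convolutions_invariant by blast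
qed

section \<open>Averaging an operator of finite propagation\<close>

text \<open>The substitution \<open>h = s \<otimes> inv t\<close> turns \<open>d s t \<le> r\<close>
  into \<open>d h \<one> \<le> r\<close> by right invariance. Every row is thus indexed by the same
  finite ball, so that rows can be averaged term by term.\<close>

lemma finite_propagation_row:
  assumes S: "S \<in> bounded_ops p (carrier G)"
    and r: "\<And>s t. s \<in> carrier G \<Longrightarrow> t \<in> carrier G \<Longrightarrow> mat_coeff S s t \<noteq> 0 \<Longrightarrow> d s t \<le> r"
    and f: "f \<in> L" and s: "s \<in> carrier G"
  shows "S f s = (\<Sum>h | h \<in> carrier G \<and> d h \<one> \<le> r. mat_coeff S s (inv h \<otimes> s) * f (inv h \<otimes> s))"
proof -
  let ?F = "{h \<in> carrier G. d h \<one> \<le> r}"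
  have "mat_coeff S s t = 0" if t: "t \<in> carrier G" "t \<notin> (\<lambda>h. inv h \<otimes> s) ` ?F" for t
  proof (rule ccontr)
    assume "mat_coeff S s t \<noteq> 0"
    then have "d s t \<le> r" using r s t by auto
    moreover have "d (s \<otimes> inv t) \<one> = d s t"
      using d_right_invariant[of "s \<otimes> inv t" \<one> t] s t by (simp add: m_assoc)
    ultimately have "s \<otimes> inv t \<in> ?F" using s t by simp
    moreover have "t = inv (s \<otimes> inv t) \<otimes> s"
      using s t by (simp add: inv_mult_group m_assoc)
    ultimately show False using t by blast
  qed
  moreover have "inj_on (\<lambda>h. inv h \<otimes> s) ?F"
    using s by (auto intro!: inj_onI) (metis inv_inv)
  moreover have "(\<lambda>h. inv h \<otimes> s) ` ?F \<subseteq> carrier G" using s by auto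
  ultimately show ?thesis
    using op_row_finite[OF S finite_imageI[OF finite_ball_one] _ f]
    by (simp add: sum.reindex)
qed

lemma finite_propagationE:
  assumes "propagation (carrier G) d S < \<infinity>"
  obtains r where "\<And>s t. s \<in> carrier G \<Longrightarrow> t \<in> carrier G \<Longrightarrow> mat_coeff S s t \<noteq> 0 \<Longrightarrow> d s t \<le> r"
proof -
  obtain r where r: "0 \<le> r" "propagation (carrier G) d S = ennreal r"
    using assms by (cases "propagation (carrier G) d S") auto
  have "d s t \<le> r" if "s \<in> carrier G" "t \<in> carrier G" "mat_coeff S s t \<noteq> 0" for s t
  proof -
    have "ennreal (d s t) \<le> ennreal r"
      unfolding r(2)[symmetric] propagation_def using that by (intro Sup_upper) blast
    then show ?thesis using r(1) by (simp add: ennreal_le_iff)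
  qed
  then show thesis using that by blast
qed

text \<open>All conjugates of \<open>T - S\<close> by right translations share its bound
  \<open>e\<close>, since translations are isometries, and Jensen's inequality carries this bound to
  their mean.\<close>

lemma invariant_approx_convolution:
  assumes m: "invariant_mean G m"
    and T: "T \<in> bounded_ops p (carrier G)"
    and inv: "\<And>g. g \<in> carrier G \<Longrightarrow> Ad_right_regular p G g T = T"
    and S: "S \<in> bounded_ops p (carrier G)" "propagation (carrier G) d S < \<infinity>"
    and e: "0 \<le> e" "\<And>f. f \<in> L \<Longrightarrow> N (\<lambda>x. T f x - S f x) \<le> e * N f"
  shows "\<exists>R\<in>convolutions. \<forall>f\<in>L. N (\<lambda>x. T f x - R f x) \<le> e * N f"
proof -
  obtain r where r: "\<And>s t. s \<in> carrier G \<Longrightarrow> t \<in> carrier G \<Longrightarrow> mat_coeff S s t \<noteq> 0 \<Longrightarrow> d s t \<le> r"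
    using finite_propagationE[OF S(2)] by blast
  define F where "F = {h \<in> carrier G. d h \<one> \<le> r}"
  \<comment> \<open>\<open>\<phi> h\<close> collects the entries of \<open>S\<close> on the diagonal
    \<open>s = h \<otimes> t\<close> as a function of the row.\<close>
  define \<phi> where "\<phi> h g = (if g \<in> carrier G then mat_coeff S g (inv h \<otimes> g) else 0)" for h g
  define R where "R = convolution F (\<lambda>h. m (\<phi> h))"
  have R: "R \<in> convolutions"
    unfolding R_def convolutions_def F_def using finite_ball_one by blast
  have FG: "h \<in> carrier G" if "h \<in> F" for h using that by (simp add: F_def)
  obtain K where K: "0 \<le> K" "\<And>f. f \<in> L \<Longrightarrow> N (S f) \<le> K * N f" by (meson op_bound[OF S(1)])
  have \<phi>: "\<phi> h \<in> ell_infty (carrier G)" if "h \<in> carrier G" for h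
  proof (rule ell_inftyI)
    fix g assume g: "g \<in> carrier G"
    then have hg: "inv h \<otimes> g \<in> carrier G" using that by simp
    have "norm (\<phi> h g) \<le> N (S (delta (inv h \<otimes> g)))"
      unfolding \<phi>_def mat_coeff_def using g norm_component_le[OF op_in[OF S(1) delta_in_ellp[OF hg]]] by simp
    also have "\<dots> \<le> K * 1"
      using K(2)[OF delta_in_ellp[OF hg]] mult_left_mono[OF norm_delta_le[OF hg] K(1)] by simp
    finally show "norm (\<phi> h g) \<le> K * 1" .
  qed (simp add: \<phi>_def)
  have "N (\<lambda>x. T f x - R f x) \<le> e * N f" if f: "f \<in> L" for f
  proof -
    define f' where "f' g = right_translate G (inv g) f" for g
    have f': "f' g \<in> L" "N (f' g) = N f" if "g \<in> carrier G" for g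
      using that f by (simp_all add: f'_def right_translate_in_ellp norm_right_translate)
    \<comment> \<open>\<open>v g\<close> is the conjugate of \<open>T - S\<close> by the right
      translation by \<open>g\<close>, applied to \<open>f\<close>.\<close>
    define v where "v g = right_translate G g (\<lambda>x. T (f' g) x - S (f' g) x)" for g
    have v: "v g \<in> L" "N (v g) \<le> e * N f" if "g \<in> carrier G" for g
    proof -
      have "(\<lambda>x. T (f' g) x - S (f' g) x) \<in> L"
        by (rule diff_in_ellp[OF op_in[OF T f'(1)[OF that]] op_in[OF S(1) f'(1)[OF that]]])
      then show "v g \<in> L" "N (v g) \<le> e * N f"
        using e(2)[OF f'(1)] f'(2) that
        by (simp_all add: v_def right_translate_in_ellp norm_right_translate)
    qed
    \<comment> \<open>At a fixed \<open>s\<close> the values of the conjugates form a bounded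
      function of \<open>g\<close>, set to 0 off the carrier; the mean acts on this
      function.\<close>
    define u where "u s g = (if g \<in> carrier G then v g s else 0)" for s g
    have u: "u s \<in> ell_infty (carrier G)" for s
      using order_trans[OF norm_component_le[OF v(1)] v(2)]
      by (intro ell_inftyI[where B = "e * N f"]) (simp_all add: u_def)
    have mean_u: "m (u s) = T f s - R f s" if s: "s \<in> carrier G" for s
    proof -
      define one :: "'a \<Rightarrow> complex" where "one = indicator (carrier G)"
      have one: "one \<in> ell_infty (carrier G)" "m one = 1"
        unfolding one_def by (rule ell_infty_indicator) (rule mean_indicator[OF m])
      have \<phi>s: "left_translate G (inv s) (\<phi> h) \<in> ell_infty (carrier G)" if h: "h \<in> F" for h
      proof -
        obtain B where "\<And>x. norm (\<phi> h x) \<le> B" using ell_inftyE[OF \<phi>[OF FG[OF h]]] by blast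
        then show ?thesis by (intro ell_inftyI[where B = B]) (auto simp: left_translate_def)
      qed
      \<comment> \<open>Conjugation fixes \<open>T\<close> and replaces the row of \<open>S\<close>
        at \<open>s\<close> by the row at \<open>s \<otimes> g\<close>. As functions of
        \<open>g\<close>, the entries of that row are \<open>\<phi> h\<close> translated on the left
        by \<open>inv s\<close>.\<close>
      have us: "u s = (\<lambda>g. T f s * one g + (-1) * (\<Sum>h\<in>F. f (inv h \<otimes> s) * left_translate G (inv s) (\<phi> h) g))"
      proof
        fix g
        show "u s g = T f s * one g + (-1) * (\<Sum>h\<in>F. f (inv h \<otimes> s) * left_translate G (inv s) (\<phi> h) g)"
        proof (cases "g \<in> carrier G")
          case g: True
          have "right_translate G g (T (f' g)) s = T f s"
            using inv[OF g] f unfolding Ad_right_regular_fixed_iff[OF T g] f'_def by metis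
          then have "u s g = T f s - S (f' g) (s \<otimes> g)"
            using g s by (simp add: u_def v_def right_translate_def)
          also have "S (f' g) (s \<otimes> g)
              = (\<Sum>h\<in>F. mat_coeff S (s \<otimes> g) (inv h \<otimes> (s \<otimes> g)) * f' g (inv h \<otimes> (s \<otimes> g)))"
            using finite_propagation_row[OF S(1) r f'(1)[OF g]] s g by (simp add: F_def)
          also have "\<dots> = (\<Sum>h\<in>F. f (inv h \<otimes> s) * left_translate G (inv s) (\<phi> h) g)"
          proof (rule sum.cong[OF refl])
            fix h assume "h \<in> F"
            then have h: "h \<in> carrier G" by (rule FG)
            show "mat_coeff S (s \<otimes> g) (inv h \<otimes> (s \<otimes> g)) * f' g (inv h \<otimes> (s \<otimes> g))
                = f (inv h \<otimes> s) * left_translate G (inv s) (\<phi> h) g"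
              using g s h by (simp add: left_translate_def \<phi>_def f'_def right_translate_def m_assoc)
          qed
          finally show ?thesis using g by (simp add: one_def)
        qed (simp add: u_def one_def left_translate_def)
      qed
      have "m (u s) = T f s - (\<Sum>h\<in>F. f (inv h \<otimes> s) * m (left_translate G (inv s) (\<phi> h)))"
      proof -
        let ?w = "\<lambda>g. \<Sum>h\<in>F. f (inv h \<otimes> s) * left_translate G (inv s) (\<phi> h) g"
        have w: "?w \<in> ell_infty (carrier G)"
          by (intro ell_infty_sum ell_infty_scale \<phi>s)
        have "m (u s) = T f s * m one + (-1) * m ?w"
          unfolding us mean_add[OF m ell_infty_scale[OF one(1)] ell_infty_scale[OF w]]
            mean_scale[OF m one(1)] mean_scale[OF m w] ..
        also have "m ?w = (\<Sum>h\<in>F. f (inv h \<otimes> s) * m (left_translate G (inv s) (\<phi> h)))"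
          using \<phi>s by (subst mean_sum[OF m]) (auto simp: ell_infty_scale mean_scale[OF m])
        finally show ?thesis using one by simp
      qed
      \<comment> \<open>Left invariance of the mean removes \<open>s\<close> from the coefficients,
        which is why the averaged operator is a convolution.\<close>
      also have "(\<Sum>h\<in>F. f (inv h \<otimes> s) * m (left_translate G (inv s) (\<phi> h))) = R f s"
        using f s FG \<phi> by (simp add: R_def convolution_def left_translate_def[of G _ f]
            mean_left_translate[OF m] mult.commute)
      finally show ?thesis .
    qed
    show ?thesis
    proof (rule norm_leI)
      have "R \<in> bounded_ops p (carrier G)" using R convolutions_bounded by blast
      then show "(\<lambda>x. T f x - R f x) \<in> L"
        using op_in T f by (intro diff_in_ellp) auto
      show "0 \<le> e * N f" using e(1) by simp
      fix X assume X: "finite X" "X \<subseteq> carrier G"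
      have "(\<Sum>x\<in>X. norm (m (u x)) powr p) \<le> (e * N f) powr p"
      proof (rule mean_Jensen[OF m p])
        fix g assume g: "g \<in> carrier G"
        have "(\<Sum>x\<in>X. norm (u x g) powr p) \<le> N (v g) powr p"
          using sum_le_norm[OF v(1)[OF g] X] g by (simp add: u_def)
        also have "\<dots> \<le> (e * N f) powr p"
          using v(2)[OF g] p by (intro powr_mono2) auto
        finally show "(\<Sum>x\<in>X. norm (u x g) powr p) \<le> (e * N f) powr p" .
      qed (rule u)
      moreover have "(\<Sum>x\<in>X. norm (m (u x)) powr p) = (\<Sum>x\<in>X. norm (T f x - R f x) powr p)"
        using X mean_u by (intro sum.cong) auto
      ultimately show "(\<Sum>x\<in>X. norm (T f x - R f x) powr p) \<le> (e * N f) powr p" by simp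
    qed
  qed
  then show ?thesis using R by blast
qed

text \<open>Amenability supplies the mean; for each \<open>e\<close> an approximant of finite
  propagation is averaged to a convolution with the same error.\<close>

lemma invariant_uniform_Roe_subset:
  assumes "amenable G"
  shows "invariant_uniform_Roe p G d \<subseteq> reduced_group_algebra p G"
proof
  obtain m where m: "invariant_mean G m" using assms by (auto simp: amenable_def)
  let ?P = "{T \<in> bounded_ops p (carrier G). propagation (carrier G) d T < \<infinity>}"
  fix T assume "T \<in> invariant_uniform_Roe p G d"
  then have T: "T \<in> op_closure p (carrier G) ?P" and
    inv: "\<And>g. g \<in> carrier G \<Longrightarrow> Ad_right_regular p G g T = T"
    by (auto simp: invariant_uniform_Roe_def uniform_Roe_def)
  have Tb: "T \<in> bounded_ops p (carrier G)" using T op_closure_bounded by blast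
  have "\<exists>R\<in>convolutions. \<forall>f\<in>L. N (\<lambda>x. T f x - R f x) \<le> e * N f" if e: "0 < e" for e
  proof -
    obtain S where "S \<in> ?P" "\<And>f. f \<in> L \<Longrightarrow> N (\<lambda>x. T f x - S f x) \<le> e * N f"
      using op_closure_approx[of ?P T e] T e by blast
    then show ?thesis
      using e by (intro invariant_approx_convolution[OF m Tb inv, of S]) auto
  qed
  then show "T \<in> reduced_group_algebra p G"
    unfolding reduced_group_algebra_eq using Tb op_closure_iff[OF convolutions_bounded] by blast
qed

end

theorem corollary4p4:
  fixes G :: "('a, 'b) monoid_scheme" and d :: "'a \<Rightarrow> 'a \<Rightarrow> real" and p :: real
  assumes "group G"
    and "proper_right_invariant_metric G d"
    and "amenable G"
    and "1 < p"
  shows "ITAP p G d"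
proof -
  interpret metric_group G d p
    using assms by (simp add: metric_group_def metric_group_axioms_def)
  show ?thesis
    unfolding ITAP_def
    using reduced_group_algebra_subset invariant_uniform_Roe_subset[OF assms(3)] by (rule antisym)
qed

end
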